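(* Let $(X,T)$ be a topological dynamical system with the marker property and with positive mean dimension, $\mathrm{mdim}(X,T)>0$. Then for any $\delta>0$ and any two distinct points $z\neq z'$ in $X$, there exist a topological dynamical system $(Y,S)$ and a factor map $\pi:(X,T)\to(Y,S)$ such that $$\pi(z)\neq\pi(z'),\qquad \mathrm{mdim}(Y,S)<\delta,\qquad \mathrm{mdim}(\pi,T)=0.$$
   Context: A topological dynamical system is a pair $(X,T)$ where $X$ is a compact metrizable space and $T:X\to X$ is a homeomorphism. A factor map $\pi:(X,T)\to(Y,S)$ is a continuous surjection $\pi:X\to Y$ with $\pi\circ T=S\circ\pi$; then $(Y,S)$ is called a factor of $(X,T)$ via $\pi$. Marker property: $(X,T)$ has the marker property if for every positive integer $N$ there is an open set $U\subset X$ with $U\cap T^nU=\emptyset$ for $0<n<N$ and $X=\bigcup_{n\in\mathbb{Z}}T^nU$. $\epsilon$-width dimension: for a compact metric space $(Z,\rho)$ and $\epsilon>0$, $\mathrm{Widim}_\epsilon(Z,\rho)$ is the smallest integer $n$ such that there is a continuous map $f:Z\to P$ into some $n$-dimensional simplicial complex $P$ with $\mathrm{diam}_\rho(f^{-1}(p))<\epsilon$ for all $p\in P$. Mean dimension: fix a compatible metric $d$ on $X$ and put $d_n(x,y)=\max_{0\le i\le n-1}d(T^ix,T^iy)$. Then $$\mathrm{mdim}(X,T)=\lim_{\epsilon\to0}\lim_{n\to\infty}\frac{\mathrm{Widim}_\epsilon(X,d_n)}{n}\in[0,\infty],$$ where the inner limit exists by subadditivity in $n$ (the value does not depend on $d$).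 Relative mean dimension of a factor map $\pi:(X,T)\to(Y,S)$: $$\mathrm{mdim}(\pi,T)=\lim_{\epsilon\to0}\lim_{n\to\infty}\frac{\sup_{y\in Y}\mathrm{Widim}_\epsilon(\pi^{-1}(y),d_n)}{n},$$ where the inner limit exists by subadditivity in $n$. *)

theory Defs
  imports "HOL-Analysis.Analysis"
begin

section \<open>Topological dynamical systems and factor maps\<close>

definition tds :: "'a topology \<Rightarrow> ('a \<Rightarrow> 'a) \<Rightarrow> bool" where
  "tds X T \<longleftrightarrow> compact_space X \<and> metrizable_space X \<and> homeomorphic_map X X T"

definition factor_map ::
    "'a topology \<Rightarrow> ('a \<Rightarrow> 'a) \<Rightarrow> 'b topology \<Rightarrow> ('b \<Rightarrow> 'b) \<Rightarrow> ('a \<Rightarrow> 'b) \<Rightarrow> bool" where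
  "factor_map X T Y S \<pi> \<longleftrightarrow>
     continuous_map X Y \<pi> \<and> \<pi> ` topspace X = topspace Y \<and>
     (\<forall>x\<in>topspace X. \<pi> (T x) = S (\<pi> x))"

text \<open>The map \<open>T\<close> need only be bijective on \<open>topspace X\<close>, so negative powers use the inverse
  relative to that carrier.\<close>

definition int_iterate :: "'a topology \<Rightarrow> ('a \<Rightarrow> 'a) \<Rightarrow> int \<Rightarrow> 'a \<Rightarrow> 'a" where
  "int_iterate X T n =
     (if n \<ge> 0 then T ^^ nat n else (inv_into (topspace X) T) ^^ nat (- n))"

definition marker_property :: "'a topology \<Rightarrow> ('a \<Rightarrow> 'a) \<Rightarrow> bool" where
  "marker_property X T \<longleftrightarrow>
     (\<forall>N::nat. N > 0 \<longrightarrow>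
        (\<exists>U. openin X U \<and>
             (\<forall>n::int. 0 < n \<and> n < int N \<longrightarrow> U \<inter> int_iterate X T n ` U = {}) \<and>
             topspace X = (\<Union>n::int. int_iterate X T n ` U)))"

section \<open>Simplicial complexes\<close>

text \<open>A (finite) simplicial complex is given by its set \<open>K\<close> of simplices, each recorded by its
  vertex set. As complexes of arbitrarily large dimension are needed inside one type, vertices are
  natural numbers and the polyhedron is described by barycentric coordinates; for finite \<open>K\<close> the
  product topology on it is the usual one.\<close>

definition finite_complex :: "nat set set \<Rightarrow> bool" where
  "finite_complex K \<longleftrightarrow>
     finite K \<and> (\<forall>\<sigma>\<in>K. finite \<sigma> \<and> \<sigma> \<noteq> {}) \<and>
     (\<forall>\<sigma>\<in>K. \<forall>\<tau>. \<tau> \<noteq> {} \<and> \<tau> \<subseteq> \<sigma> \<longrightarrow> \<tau> \<in> K)"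

definition complex_has_dim :: "nat set set \<Rightarrow> nat \<Rightarrow> bool" where
  "complex_has_dim K n \<longleftrightarrow> (\<exists>\<sigma>\<in>K. card \<sigma> = Suc n) \<and> (\<forall>\<sigma>\<in>K. card \<sigma> \<le> Suc n)"

definition polyhedron_of :: "nat set set \<Rightarrow> (nat \<Rightarrow> real) topology" where
  "polyhedron_of K =
     subtopology (powertop_real UNIV)
       {x. (\<forall>i. 0 \<le> x i) \<and> {i. x i \<noteq> 0} \<in> K \<and> (\<Sum>i | x i \<noteq> 0. x i) = 1}"

section \<open>Width dimension\<close>

text \<open>Valued in \<open>ennreal\<close>, so that the diameter of the empty set is \<open>0\<close>.\<close>

definition diam :: "('a \<Rightarrow> 'a \<Rightarrow> real) \<Rightarrow> 'a set \<Rightarrow> ennreal" where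
  "diam \<rho> A = (SUP x\<in>A. SUP y\<in>A. ennreal (\<rho> x y))"

text \<open>The infimum in \<open>enat\<close> is a minimum whenever some \<open>n\<close> qualifies, which is
  always so if \<open>(Z,\<rho>)\<close> is a compact metric space and \<open>\<epsilon> > 0\<close>.\<close>

definition Widim :: "real \<Rightarrow> 'a set \<Rightarrow> ('a \<Rightarrow> 'a \<Rightarrow> real) \<Rightarrow> enat" where
  "Widim \<epsilon> Z \<rho> =
     Inf {enat n |n. \<exists>K f. finite_complex K \<and> complex_has_dim K n \<and>
            continuous_map (Metric_space.mtopology Z \<rho>) (polyhedron_of K) f \<and>
            (\<forall>p\<in>topspace (polyhedron_of K). diam \<rho> {z\<in>Z. f z = p} < ennreal \<epsilon>)}"

section \<open>Mean dimension and relative mean dimension\<close>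

definition compatible_metric :: "'a topology \<Rightarrow> ('a \<Rightarrow> 'a \<Rightarrow> real) \<Rightarrow> bool" where
  "compatible_metric X d \<longleftrightarrow>
     Metric_space (topspace X) d \<and> Metric_space.mtopology (topspace X) d = X"

text \<open>Only used for \<open>n > 0\<close>; the value at \<open>n = 0\<close> does not affect the limits below.\<close>

definition dyn_metric :: "('a \<Rightarrow> 'a) \<Rightarrow> ('a \<Rightarrow> 'a \<Rightarrow> real) \<Rightarrow> nat \<Rightarrow> 'a \<Rightarrow> 'a \<Rightarrow> real" where
  "dyn_metric T d n x y = Max ((\<lambda>i. d ((T ^^ i) x) ((T ^^ i) y)) ` {..<n})"

definition mdim_wrt :: "('a \<Rightarrow> 'a \<Rightarrow> real) \<Rightarrow> 'a topology \<Rightarrow> ('a \<Rightarrow> 'a) \<Rightarrow> ereal" where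
  "mdim_wrt d X T =
     Lim (at_right (0::real))
       (\<lambda>\<epsilon>. lim (\<lambda>n. ereal_of_enat (Widim \<epsilon> (topspace X) (dyn_metric T d n)) / ereal (real n)))"

definition rel_mdim_wrt ::
    "('a \<Rightarrow> 'a \<Rightarrow> real) \<Rightarrow> 'a topology \<Rightarrow> ('a \<Rightarrow> 'a) \<Rightarrow> 'b topology \<Rightarrow> ('a \<Rightarrow> 'b) \<Rightarrow> ereal" where
  "rel_mdim_wrt d X T Y \<pi> =
     Lim (at_right (0::real))
       (\<lambda>\<epsilon>. lim (\<lambda>n.
          ereal_of_enat (SUP y\<in>topspace Y. Widim \<epsilon> {x\<in>topspace X. \<pi> x = y} (dyn_metric T d n))
            / ereal (real n)))"

text \<open>Both quantities are independent of the compatible metric, so we fix an arbitrary one.\<close>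

definition mdim :: "'a topology \<Rightarrow> ('a \<Rightarrow> 'a) \<Rightarrow> ereal" where
  "mdim X T = mdim_wrt (SOME d. compatible_metric X d) X T"

definition rel_mdim :: "'a topology \<Rightarrow> ('a \<Rightarrow> 'a) \<Rightarrow> 'b topology \<Rightarrow> ('a \<Rightarrow> 'b) \<Rightarrow> ereal" where
  "rel_mdim X T Y \<pi> = rel_mdim_wrt (SOME d. compatible_metric X d) X T Y \<pi>"

end

theory Submission
  imports Defs
begin

text \<open>Let \<open>u\<^sub>1, \<dots>, u\<^sub>q\<close> be bump functions whose supports are small, at least one of which is positive
  at each point. Sort their values decreasingly: wherever there is a strict drop after the \<open>k\<close>-th
  value, the set of the \<open>k\<close> largest is locally constant. Let \<open>F\<^sub>j\<close> be the total size of the drops with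
  \<open>k \<equiv> j\<close> mod \<open>m + 1\<close>. Some \<open>F\<^sub>j\<close> is positive, and on a fibre of \<open>(F\<^sub>0, \<dots>, F\<^sub>m)\<close> the top sets belonging
  to such a \<open>j\<close> give small open sets of multiplicity about \<open>q / (m + 1)\<close>. So \<open>m + 1\<close> real functions
  divide the width dimension of fibres by \<open>m + 1\<close>: the Hurewicz bound is multiplicative, not additive.

  Dynamically, the marker property gives a function \<open>\<phi>\<close> whose positive times along any orbit are at
  least \<open>L\<close> apart. The power diagram of these times with weights \<open>\<phi>\<close> tiles the orbit by blocks that
  vary continuously, and each block is encoded as above, with the values stored at its marker.
  The resulting factor has mean dimension of order \<open>m / L\<close>, while a fibre, on which the tiling is
  fixed, has mean width of order \<open>1 / m + 1 / L\<close>. Taking \<open>m\<close> and then \<open>L\<close> large, and the product over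
  a sequence of scales tending to \<open>0\<close>, gives the theorem. One further function supported on the
  markers separates the two points.\<close>

section \<open>Width dimension in barycentric coordinates\<close>

text \<open>Storing a block costs \<open>m + 1\<close> numbers, whatever its length. If N bumps are
  used at scale \<epsilon>, a block of length l carries about N l of them, and the stored numbers
  cut its width to about N l / (m + 1) plus one. The extra one is paid once per block, hence at rate
  1 / L. So m is chosen from N and the target, and L only afterwards, large compared with m, which
  keeps the rate (m + 3) / L of stored values small. The obstacle is continuity: a sharp tiling of
  an orbit jumps as the point moves. Membership in a block is therefore measured by a margin that
  fades to 0 near the ends of its cell. The few times lost in this way, a bounded number per
  boundary, are covered by all N bumps without compression, at a cost of order N / L. Lower bounds
  are free, since widths are nonnegative; the work goes into upper bounds that are affine in n, with
  a constant that may depend on \<epsilon>.\<close>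

definition width_coords ::
    "real \<Rightarrow> 'a set \<Rightarrow> ('a \<Rightarrow> 'a \<Rightarrow> real) \<Rightarrow> nat \<Rightarrow> 'v set \<Rightarrow> ('v \<Rightarrow> 'a \<Rightarrow> real) \<Rightarrow> bool" where
  "width_coords \<epsilon> Z \<rho> D V h \<longleftrightarrow> finite V \<and>
     (\<forall>v\<in>V. continuous_map (Metric_space.mtopology Z \<rho>) euclideanreal (h v)) \<and>
     (\<forall>v\<in>V. \<forall>z\<in>Z. 0 \<le> h v z) \<and>
     (\<forall>z\<in>Z. (\<Sum>v\<in>V. h v z) = 1) \<and>
     (\<forall>z\<in>Z. card {v\<in>V. h v z \<noteq> 0} \<le> Suc D) \<and>
     (\<forall>z\<in>Z. diam \<rho> {w\<in>Z. \<forall>v\<in>V. h v w = h v z} < ennreal \<epsilon>)"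

lemma diam_empty [simp]: "diam \<rho> {} = 0"
  by (simp add: diam_def bot_ennreal)

lemma diam_le: "(\<And>x y. x \<in> A \<Longrightarrow> y \<in> A \<Longrightarrow> \<rho> x y \<le> e) \<Longrightarrow> diam \<rho> A \<le> ennreal e"
  unfolding diam_def by (intro SUP_least ennreal_leI) auto

lemma le_diam: "x \<in> A \<Longrightarrow> y \<in> A \<Longrightarrow> ennreal (\<rho> x y) \<le> diam \<rho> A"
  unfolding diam_def by (meson SUP_upper2 order_refl)

lemma diam_mono: "A \<subseteq> B \<Longrightarrow> diam \<rho> A \<le> diam \<rho> B"
  unfolding diam_def by (intro SUP_subset_mono) auto

text \<open>The complex is the \<open>D\<close>-skeleton of the full simplex on \<open>V\<close>,
  and \<open>f\<close> lists the barycentric coordinates. Keeping the vertices in an arbitrary type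
  until here lets later constructions index coordinates by sums and products of sets.\<close>

lemma width_coords_imp_Widim_le:
  assumes ms: "Metric_space Z \<rho>" and Z: "Z \<noteq> {}" and w: "width_coords \<epsilon> Z \<rho> D V h"
  shows "Widim \<epsilon> Z \<rho> \<le> enat D"
proof -
  interpret Metric_space Z \<rho> by fact
  have fin: "finite V" and cont: "\<And>v. v \<in> V \<Longrightarrow> continuous_map mtopology euclideanreal (h v)"
    and nn: "\<And>v z. v \<in> V \<Longrightarrow> z \<in> Z \<Longrightarrow> 0 \<le> h v z"
    and sum1: "\<And>z. z \<in> Z \<Longrightarrow> (\<Sum>v\<in>V. h v z) = 1"
    and crd: "\<And>z. z \<in> Z \<Longrightarrow> card {v\<in>V. h v z \<noteq> 0} \<le> Suc D"
    and dm: "\<And>z. z \<in> Z \<Longrightarrow> diam \<rho> {w\<in>Z. \<forall>v\<in>V. h v w = h v z} < ennreal \<epsilon>"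
    using w unfolding width_coords_def by auto
  define N where "N = card V"
  obtain b where b: "bij_betw b {..<N} V"
    using ex_bij_betw_nat_finite[OF fin] unfolding N_def atLeast0LessThan by blast
  have bV: "b i \<in> V" if "i < N" for i using b that by (auto simp: bij_betw_def)
  have Npos: "N > 0" using sum1 Z fin unfolding N_def by (cases "V = {}") (auto simp: card_gt_0_iff)
  define f where "f z i = (if i < N then h (b i) z else 0)" for z i
  \<comment> \<open>The complex must attain its dimension: with fewer than \<open>D + 1\<close>
    vertices the skeleton is the whole simplex, of dimension \<open>N - 1\<close>.\<close>
  define n where "n = min D (N - 1)"
  define K where "K = {\<sigma>. \<sigma> \<noteq> {} \<and> \<sigma> \<subseteq> {..<N} \<and> card \<sigma> \<le> Suc D}"
  have "finite K" unfolding K_def by (rule finite_subset[of _ "Pow {..<N}"]) auto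
  then have K: "finite_complex K"
    unfolding finite_complex_def K_def
    by (auto intro: finite_subset) (meson card_mono finite_lessThan finite_subset le_trans)
  have cardle: "card \<sigma> \<le> N" if "\<sigma> \<subseteq> {..<N}" for \<sigma>
    using card_mono[OF _ that] by simp
  have "{..n} \<in> K" using Npos unfolding K_def n_def by auto
  then have dimK: "complex_has_dim K n"
    unfolding complex_has_dim_def
    by (intro conjI bexI[of _ "{..n}"]) (use Npos in \<open>auto simp: K_def n_def dest!: cardle\<close>)
  have supp: "{i. f z i \<noteq> 0} = {i. i < N \<and> h (b i) z \<noteq> 0}" for z by (auto simp: f_def)
  have csupp: "card {i. f z i \<noteq> 0} = card {v\<in>V. h v z \<noteq> 0}" for z
  proof -
    have "bij_betw b {i. i < N \<and> h (b i) z \<noteq> 0} {v\<in>V. h v z \<noteq> 0}"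
      using b unfolding bij_betw_def by (auto simp: inj_on_def)
    then show ?thesis unfolding supp by (rule bij_betw_same_card)
  qed
  have sumf: "(\<Sum>i | f z i \<noteq> 0. f z i) = 1" if "z \<in> Z" for z
  proof -
    have "(\<Sum>i | f z i \<noteq> 0. f z i) = (\<Sum>i<N. h (b i) z)"
      unfolding supp by (rule sum.mono_neutral_cong_left) (auto simp: f_def)
    also have "\<dots> = (\<Sum>v\<in>V. h v z)" using sum.reindex_bij_betw[OF b] .
    finally show ?thesis using sum1[OF that] by simp
  qed
  have inP: "f z \<in> topspace (polyhedron_of K)" if z: "z \<in> Z" for z
  proof -
    have "{i. f z i \<noteq> 0} \<noteq> {}" using sumf[OF z] by force
    then have "{i. f z i \<noteq> 0} \<in> K" using csupp[of z] crd[OF z] supp[of z] unfolding K_def by auto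
    then show ?thesis using sumf[OF z] nn[OF bV z] by (auto simp: polyhedron_of_def f_def)
  qed
  have contf: "continuous_map mtopology (polyhedron_of K) f"
    unfolding polyhedron_of_def continuous_map_in_subtopology
  proof (intro conjI)
    show "continuous_map mtopology (powertop_real UNIV) f"
      unfolding continuous_map_componentwise_UNIV using cont bV by (auto simp: f_def)
    show "f \<in> topspace mtopology \<rightarrow> {x. (\<forall>i. 0 \<le> x i) \<and> {i. x i \<noteq> 0} \<in> K \<and> (\<Sum>i | x i \<noteq> 0. x i) = 1}"
      using inP unfolding polyhedron_of_def by auto
  qed
  \<comment> \<open>Serves the points of the polyhedron outside the image of \<open>f\<close>, whose
    fibre is empty and has diameter 0.\<close>
  have eps: "\<epsilon> > 0"
  proof (rule ccontr)
    assume "\<not> \<epsilon> > 0"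
    then have "ennreal \<epsilon> = 0" by (simp add: ennreal_neg)
    then show False using dm Z by force
  qed
  have "diam \<rho> {z\<in>Z. f z = p} < ennreal \<epsilon>" for p
  proof (cases "{z\<in>Z. f z = p} = {}")
    case True then show ?thesis using eps by (simp only: diam_empty) auto
  next
    case False
    then obtain z where z: "z \<in> Z" "f z = p" by auto
    have "h v w = h v z" if fw: "f w = f z" and v: "v \<in> V" for v w
    proof -
      obtain i where "i < N" "b i = v" using b v by (auto simp: bij_betw_def)
      then show ?thesis using fun_cong[OF fw, of i] by (simp add: f_def)
    qed
    then have "{x\<in>Z. f x = p} \<subseteq> {w\<in>Z. \<forall>v\<in>V. h v w = h v z}"
      unfolding z(2)[symmetric] by blast
    then show ?thesis using diam_mono dm[OF z(1)] le_less_trans by blast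
  qed
  then have "Widim \<epsilon> Z \<rho> \<le> enat n"
    unfolding Widim_def using K dimK contf by (intro Inf_lower) auto
  also have "\<dots> \<le> enat D" by (simp add: n_def)
  finally show ?thesis .
qed

lemma Widim_le_imp_width_coords:
  assumes ms: "Metric_space Z \<rho>" and w: "Widim \<epsilon> Z \<rho> \<le> enat D"
  shows "\<exists>(V::nat set) h. width_coords \<epsilon> Z \<rho> D V h"
proof -
  interpret Metric_space Z \<rho> by fact
  let ?S = "{enat n |n. \<exists>K f. finite_complex K \<and> complex_has_dim K n \<and>
            continuous_map mtopology (polyhedron_of K) f \<and>
            (\<forall>p\<in>topspace (polyhedron_of K). diam \<rho> {z\<in>Z. f z = p} < ennreal \<epsilon>)}"
  have "?S \<noteq> {}" using w unfolding Widim_def by (metis Inf_empty enat_ord_simps(5) top_enat_def enat.distinct(1))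
  \<comment> \<open>A nonempty set of \<open>enat\<close> contains its infimum, so an optimal
    complex exists; its dimension may be smaller than \<open>D\<close>.\<close>
  then have "Inf ?S \<in> ?S" by (metis (no_types, lifting) Inf_enat_def LeastI_ex ex_in_conv)
  then obtain n K f where n: "Widim \<epsilon> Z \<rho> = enat n" and K: "finite_complex K" "complex_has_dim K n"
    and f: "continuous_map mtopology (polyhedron_of K) f"
    and dm: "\<And>p. p\<in>topspace (polyhedron_of K) \<Longrightarrow> diam \<rho> {z\<in>Z. f z = p} < ennreal \<epsilon>"
    unfolding Widim_def by blast
  have nD: "n \<le> D" using w n by simp
  define V where "V = \<Union>K"
  have finV: "finite V" using K(1) by (auto simp: V_def finite_complex_def)
  have fP: "f z \<in> topspace (polyhedron_of K)" if "z \<in> Z" for z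
    using f that by (auto simp: continuous_map_def)
  then have nn: "0 \<le> f z i" and inK: "{i. f z i \<noteq> 0} \<in> K" and s1: "(\<Sum>i | f z i \<noteq> 0. f z i) = 1"
    if "z \<in> Z" for z i using that by (auto simp: polyhedron_of_def)
  have sub: "{i. f z i \<noteq> 0} \<subseteq> V" if "z \<in> Z" for z using inK[OF that] by (auto simp: V_def)
  have "continuous_map mtopology (powertop_real UNIV) f"
    using f unfolding polyhedron_of_def continuous_map_in_subtopology by blast
  then have c: "continuous_map mtopology euclideanreal (\<lambda>z. f z i)" for i
    unfolding continuous_map_componentwise_UNIV by auto
  have "width_coords \<epsilon> Z \<rho> D V (\<lambda>i z. f z i)"
    unfolding width_coords_def
  proof (intro conjI ballI)
    fix z assume z: "z \<in> Z"
    show "(\<Sum>v\<in>V. f z v) = 1"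
      using sum.mono_neutral_left[OF finV sub[OF z], of "f z"] s1[OF z] by auto
    have "{v\<in>V. f z v \<noteq> 0} = {v. f z v \<noteq> 0}" using sub[OF z] by auto
    then show "card {v\<in>V. f z v \<noteq> 0} \<le> Suc D"
      using K(2) inK[OF z] nD unfolding complex_has_dim_def by (metis Suc_le_mono le_trans)
    have "f w i = f z i" if "w \<in> Z" "\<forall>v\<in>V. f w v = f z v" for w i
    proof (cases "i \<in> V")
      case False
      then have "f w i = 0" "f z i = 0" using sub[OF z] sub[OF that(1)] by blast+
      then show ?thesis by simp
    qed (use that in blast)
    then have "{w\<in>Z. \<forall>v\<in>V. f w v = f z v} \<subseteq> {w\<in>Z. f w = f z}" by blast
    then show "diam \<rho> {w\<in>Z. \<forall>v\<in>V. f w v = f z v} < ennreal \<epsilon>"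
      using dm[OF fP[OF z]] diam_mono le_less_trans by blast
  qed (use finV c nn in auto)
  then show ?thesis by blast
qed

text \<open>Dividing by the sum gives the nerve map of the cover by the sets where some
  \<open>h v\<close> is positive. Equal coordinates have equal supports, so smallness is asked only
  of points with the same positivity pattern. The room between \<open>e\<close> and \<epsilon>
  restores the strict inequality that a supremum loses.\<close>

lemma Widim_le_support:
  assumes ms: "Metric_space Z \<rho>" and Z: "Z \<noteq> {}" and fin: "finite V"
    and cont: "\<And>v. v \<in> V \<Longrightarrow> continuous_map (Metric_space.mtopology Z \<rho>) euclideanreal (h v)"
    and nn: "\<And>v z. v \<in> V \<Longrightarrow> z \<in> Z \<Longrightarrow> 0 \<le> h v z"
    and pos: "\<And>z. z \<in> Z \<Longrightarrow> \<exists>v\<in>V. 0 < h v z"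
    and crd: "\<And>z. z \<in> Z \<Longrightarrow> card {v\<in>V. 0 < h v z} \<le> Suc D"
    and small: "\<And>z w. z \<in> Z \<Longrightarrow> w \<in> Z \<Longrightarrow> (\<And>v. v \<in> V \<Longrightarrow> 0 < h v z \<longleftrightarrow> 0 < h v w) \<Longrightarrow> \<rho> z w \<le> e"
    and e: "e < \<epsilon>"
  shows "Widim \<epsilon> Z \<rho> \<le> enat D"
proof -
  interpret Metric_space Z \<rho> by fact
  define s where "s z = (\<Sum>v\<in>V. h v z)" for z
  have s: "s z > 0" if "z \<in> Z" for z
    unfolding s_def using pos[OF that] nn[OF _ that] fin by (meson sum_pos2)
  have e0: "0 \<le> e" using Z small by (metis all_not_in_conv mdist_zero)
  have "width_coords \<epsilon> Z \<rho> D V (\<lambda>v z. h v z / s z)"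
    unfolding width_coords_def
  proof (intro conjI ballI)
    fix z assume z: "z \<in> Z"
    show "(\<Sum>v\<in>V. h v z / s z) = 1"
      using s[OF z] unfolding s_def by (simp flip: sum_divide_distrib)
    have "{v\<in>V. h v z / s z \<noteq> 0} = {v\<in>V. 0 < h v z}"
      using s[OF z] nn[OF _ z] by (auto simp: less_le)
    then show "card {v\<in>V. h v z / s z \<noteq> 0} \<le> Suc D" using crd[OF z] by simp
    let ?A = "{w\<in>Z. \<forall>v\<in>V. h v w / s w = h v z / s z}"
    have "\<rho> x y \<le> e" if "x \<in> ?A" "y \<in> ?A" for x y
    proof (rule small)
      fix v assume v: "v \<in> V"
      have "h v x / s x = h v y / s y" using that v by auto
      moreover have "0 < h v x / s x \<longleftrightarrow> 0 < h v x" "0 < h v y / s y \<longleftrightarrow> 0 < h v y"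
        using s that by (simp_all add: zero_less_divide_iff) (metis less_asym)+
      ultimately show "0 < h v x \<longleftrightarrow> 0 < h v y" by simp
    qed (use that in auto)
    then have "diam \<rho> ?A \<le> ennreal e" by (rule diam_le)
    also have "\<dots> < ennreal \<epsilon>" using e e0 by (simp add: ennreal_less_iff)
    finally show "diam \<rho> ?A < ennreal \<epsilon>" .
  next
    fix v assume v: "v \<in> V"
    show "continuous_map mtopology euclideanreal (\<lambda>z. h v z / s z)"
    proof (rule continuous_map_real_divide)
      show "continuous_map mtopology euclideanreal s"
        unfolding s_def by (intro continuous_map_sum fin cont)
    qed (use s v cont in \<open>force+\<close>)
    show "0 \<le> h v z / s z" if "z \<in> Z" for z using nn[OF v that] s[OF that] by simp
  qed fact
  then show ?thesis by (rule width_coords_imp_Widim_le[OF ms Z])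
qed

text \<open>Transfers continuity to \<open>dyn_metric\<close>: the identity from it to the original
  metric is 1-Lipschitz, so one inequality replaces a comparison of two topologies.\<close>

lemma continuous_map_lipschitz:
  assumes "Metric_space Z \<rho>" "Metric_space Z' \<rho>'" "g ` Z \<subseteq> Z'"
    and "\<And>x y. x \<in> Z \<Longrightarrow> y \<in> Z \<Longrightarrow> \<rho>' (g x) (g y) \<le> \<rho> x y"
  shows "continuous_map (Metric_space.mtopology Z \<rho>) (Metric_space.mtopology Z' \<rho>') g"
proof -
  interpret Metric_space Z \<rho> by fact
  show ?thesis unfolding metric_continuous_map[OF assms(2)]
    using assms(3,4) by (meson le_less_trans)
qed

lemma Widim_mono_eps: "\<epsilon> \<le> \<epsilon>' \<Longrightarrow> Widim \<epsilon>' Z \<rho> \<le> Widim \<epsilon> Z \<rho>"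
  unfolding Widim_def
  by (rule Inf_superset_mono) (use ennreal_leI less_le_trans in blast)

text \<open>The join of two polyhedra has dimension one more than the sum of the dimensions; using it
  instead of the product avoids triangulating a product.\<close>

lemma Widim_join:
  assumes ms: "Metric_space Z \<rho>" "Metric_space Z1 \<rho>1" "Metric_space Z2 \<rho>2" and Z: "Z \<noteq> {}"
    and g1: "g1 ` Z \<subseteq> Z1" "\<And>x y. x \<in> Z \<Longrightarrow> y \<in> Z \<Longrightarrow> \<rho>1 (g1 x) (g1 y) \<le> \<rho> x y"
    and g2: "g2 ` Z \<subseteq> Z2" "\<And>x y. x \<in> Z \<Longrightarrow> y \<in> Z \<Longrightarrow> \<rho>2 (g2 x) (g2 y) \<le> \<rho> x y"
    and max: "\<And>x y. x \<in> Z \<Longrightarrow> y \<in> Z \<Longrightarrow> \<rho> x y \<le> max (\<rho>1 (g1 x) (g1 y)) (\<rho>2 (g2 x) (g2 y))"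
    and le: "Widim \<epsilon> Z1 \<rho>1 \<le> enat D1" "Widim \<epsilon> Z2 \<rho>2 \<le> enat D2"
  shows "Widim \<epsilon> Z \<rho> \<le> enat (D1 + D2 + 1)"
proof -
  obtain V1 :: "nat set" and h1 where w1: "width_coords \<epsilon> Z1 \<rho>1 D1 V1 h1"
    using Widim_le_imp_width_coords[OF ms(2) le(1)] by blast
  obtain V2 :: "nat set" and h2 where w2: "width_coords \<epsilon> Z2 \<rho>2 D2 V2 h2"
    using Widim_le_imp_width_coords[OF ms(3) le(2)] by blast
  note w1' = w1[unfolded width_coords_def] and w2' = w2[unfolded width_coords_def]
  define h where "h v x = (case v of Inl i \<Rightarrow> h1 i (g1 x) / 2 | Inr j \<Rightarrow> h2 j (g2 x) / 2)" for v x
  have c1: "continuous_map (Metric_space.mtopology Z \<rho>) (Metric_space.mtopology Z1 \<rho>1) g1"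
    by (rule continuous_map_lipschitz[OF ms(1,2) g1])
  have c2: "continuous_map (Metric_space.mtopology Z \<rho>) (Metric_space.mtopology Z2 \<rho>2) g2"
    by (rule continuous_map_lipschitz[OF ms(1,3) g2])
  have "width_coords \<epsilon> Z \<rho> (D1 + D2 + 1) (V1 <+> V2) h"
    unfolding width_coords_def
  proof (intro conjI ballI)
    show "finite (V1 <+> V2)" using w1' w2' by auto
    fix v assume v: "v \<in> V1 <+> V2"
    have "continuous_map (Metric_space.mtopology Z \<rho>) euclideanreal (\<lambda>x. h1 i (g1 x))" if "i \<in> V1" for i
      using continuous_map_compose[OF c1, of euclideanreal "h1 i"] w1' that by (simp add: o_def)
    moreover have "continuous_map (Metric_space.mtopology Z \<rho>) euclideanreal (\<lambda>x. h2 i (g2 x))" if "i \<in> V2" for i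
      using continuous_map_compose[OF c2, of euclideanreal "h2 i"] w2' that by (simp add: o_def)
    ultimately show "continuous_map (Metric_space.mtopology Z \<rho>) euclideanreal (h v)"
      using v unfolding h_def
      by (cases v) (auto intro!: continuous_map_real_divide)
    fix z assume z: "z \<in> Z"
    show "0 \<le> h v z" using v z w1' w2' g1(1) g2(1) by (auto simp: h_def split: sum.split)
  next
    fix z assume z: "z \<in> Z"
    have gz: "g1 z \<in> Z1" "g2 z \<in> Z2" using z g1(1) g2(1) by auto
    have "(\<Sum>v\<in>V1 <+> V2. h v z) = (\<Sum>i\<in>V1. h1 i (g1 z)) / 2 + (\<Sum>j\<in>V2. h2 j (g2 z)) / 2"
      using w1' w2' by (simp add: sum.Plus h_def sum_divide_distrib)
    then show "(\<Sum>v\<in>V1 <+> V2. h v z) = 1" using w1' w2' gz by simp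
    have "{v \<in> V1 <+> V2. h v z \<noteq> 0} = {i\<in>V1. h1 i (g1 z) \<noteq> 0} <+> {j\<in>V2. h2 j (g2 z) \<noteq> 0}"
      by (auto simp: h_def)
    moreover have "card {i\<in>V1. h1 i (g1 z) \<noteq> 0} \<le> Suc D1" "card {j\<in>V2. h2 j (g2 z) \<noteq> 0} \<le> Suc D2"
      using w1' w2' gz by auto
    ultimately show "card {v \<in> V1 <+> V2. h v z \<noteq> 0} \<le> Suc (D1 + D2 + 1)"
      using w1' w2' by (simp add: card_Plus)
    let ?A = "{w \<in> Z. \<forall>v\<in>V1 <+> V2. h v w = h v z}"
    let ?A1 = "{w \<in> Z1. \<forall>v\<in>V1. h1 v w = h1 v (g1 z)}" and ?A2 = "{w \<in> Z2. \<forall>v\<in>V2. h2 v w = h2 v (g2 z)}"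
    have "diam \<rho> ?A \<le> max (diam \<rho>1 ?A1) (diam \<rho>2 ?A2)"
      unfolding diam_def[of \<rho>]
    proof (intro SUP_least)
      fix x y assume x: "x \<in> ?A" and y: "y \<in> ?A"
      have e: "h1 i (g1 w) = h1 i (g1 z)" if "w \<in> ?A" "i \<in> V1" for w i
      proof -
        have "h (Inl i) w = h (Inl i) z" using that by blast
        then show ?thesis by (simp add: h_def)
      qed
      have e': "h2 i (g2 w) = h2 i (g2 z)" if "w \<in> ?A" "i \<in> V2" for w i
      proof -
        have "h (Inr i) w = h (Inr i) z" using that by blast
        then show ?thesis by (simp add: h_def)
      qed
      have "g1 x \<in> ?A1" "g1 y \<in> ?A1" "g2 x \<in> ?A2" "g2 y \<in> ?A2" using x y e e' g1(1) g2(1) by auto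
      then have "ennreal (\<rho>1 (g1 x) (g1 y)) \<le> diam \<rho>1 ?A1" "ennreal (\<rho>2 (g2 x) (g2 y)) \<le> diam \<rho>2 ?A2"
        by - (rule le_diam; assumption)+
      moreover have "ennreal (\<rho> x y) \<le> max (ennreal (\<rho>1 (g1 x) (g1 y))) (ennreal (\<rho>2 (g2 x) (g2 y)))"
        using max[of x y] x y by (auto simp: le_max_iff_disj intro: ennreal_leI)
      ultimately show "ennreal (\<rho> x y) \<le> max (diam \<rho>1 ?A1) (diam \<rho>2 ?A2)"
        by (meson max.mono order_trans)
    qed
    also have "\<dots> < ennreal \<epsilon>" using w1' w2' gz by simp
    finally show "diam \<rho> ?A < ennreal \<epsilon>" .
  qed
  then show ?thesis by (rule width_coords_imp_Widim_le[OF ms(1) Z])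
qed

section \<open>Existence of the limits defining mean dimension\<close>

text \<open>Fekete's lemma. Subadditivity is asked only of positive arguments because at 0 the
  dynamical metric is the maximum of an empty set.\<close>

lemma subadditive_converges:
  fixes b :: "nat \<Rightarrow> real"
  assumes nn: "\<And>n. 0 \<le> b n" and sub: "\<And>n m. n > 0 \<Longrightarrow> m > 0 \<Longrightarrow> b (n + m) \<le> b n + b m"
  shows "\<exists>l. (\<lambda>n. b n / real n) \<longlonglongrightarrow> l"
proof -
  define L where "L = (INF n\<in>{1..}. b n / real n)"
  have bdd: "bdd_below ((\<lambda>n. b n / real n) ` {1..})" by (rule bdd_belowI[of _ 0]) (auto simp: nn)
  have lower: "L \<le> b n / real n" if "n > 0" for n
    unfolding L_def using that by (intro cINF_lower bdd) auto
  have "(\<lambda>n. b n / real n) \<longlonglongrightarrow> L"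
  proof (rule LIMSEQ_I)
    fix r :: real assume r: "r > 0"
    then have "\<exists>k\<in>{1..}. b k / real k < L + r / 2"
      using cINF_lower2[OF bdd] by (intro cINF_less_iff[OF _ bdd, THEN iffD1]) (auto simp: L_def)
    then obtain k where k: "k > 0" "b k / real k < L + r / 2"
      by (meson atLeast_iff less_eq_Suc_le One_nat_def less_le_trans zero_less_one)
    define C where "C = (\<Sum>i<k. b i)"
    have C0: "C \<ge> 0" unfolding C_def by (intro sum_nonneg nn)
    have bC: "b i \<le> C" if "i < k" for i
      unfolding C_def using that by (intro member_le_sum nn) auto
    \<comment> \<open>Peel off blocks of length \<open>k\<close>; the remainder \<open>i < k\<close>
      is absorbed by \<open>C\<close>. The index 0 is kept out, where subadditivity says
      nothing.\<close>
    have ind: "b (q * k + i) \<le> real q * b k + C" if "q * k + i > 0" "i < k" for q i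
      using that(1)
    proof (induction q)
      case 0 then show ?case using bC[OF that(2)] by simp
    next
      case (Suc q)
      show ?case
      proof (cases "q * k + i = 0")
        case True then show ?thesis using C0 k by (auto simp: algebra_simps)
      next
        case False
        then have "b (k + (q * k + i)) \<le> b k + b (q * k + i)" using k by (intro sub) auto
        then show ?thesis using Suc False by (simp add: algebra_simps)
      qed
    qed
    obtain n0 :: nat where n0: "real n0 > 2 * C / r" using reals_Archimedean2 by blast
    show "\<exists>no. \<forall>n\<ge>no. norm (b n / real n - L) < r"
    proof (intro exI[of _ "Suc n0"] allI impI)
      fix n assume n: "Suc n0 \<le> n"
      then have n': "n > 0" "real n > 2 * C / r" using n0 by auto
      have "b n \<le> real (n div k) * b k + C"
        using ind[of "n div k" "n mod k"] n' k by simp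
      also have "\<dots> \<le> real n / real k * b k + C"
        using of_nat_div_le_of_nat[of n k, where 'a = real] nn[of k] by (intro add_right_mono mult_right_mono) auto
      finally have "b n / real n \<le> b k / real k + C / real n"
        using n' k by (simp add: field_simps)
      moreover have "C / real n < r / 2" using n' r by (simp add: field_simps)
      ultimately show "norm (b n / real n - L) < r"
        unfolding real_norm_def using lower[OF n'(1)] k(2) by linarith
    qed
  qed
  then show ?thesis by blast
qed

text \<open>The defect 1 comes from the join; adding 1 to every width absorbs it and disappears
  after division by \<open>n\<close>. A natural number \<open>D\<close> in the bound also makes the
  widths finite.\<close>

lemma enat_subadditive_mean:
  fixes W :: "nat \<Rightarrow> enat" and \<alpha> C :: real
  assumes sub: "\<And>n m. n > 0 \<Longrightarrow> m > 0 \<Longrightarrow> W (n + m) \<le> W n + W m + 1"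
    and bound: "\<And>n. n > 0 \<Longrightarrow> \<exists>D. W n \<le> enat D \<and> real D \<le> \<alpha> * real n + C"
  shows "\<exists>l. 0 \<le> l \<and> l \<le> \<alpha> \<and> (\<lambda>n. ereal_of_enat (W n) / ereal (real n)) \<longlonglongrightarrow> ereal l"
proof -
  define w where "w n = the_enat (W n)" for n
  have W: "W n = enat (w n)" if "n > 0" for n
    using bound[OF that] unfolding w_def by (metis enat_ile the_enat.simps)
  have "w (n + m) + 1 \<le> (w n + 1) + (w m + 1)" if "n > 0" "m > 0" for n m
    using sub[OF that] W[of n] W[of m] W[of "n + m"] that by (simp add: one_enat_def)
  then have "real (w (n + m)) + 1 \<le> (real (w n) + 1) + (real (w m) + 1)" if "n > 0" "m > 0" for n m
    using that by (simp add: algebra_simps flip: of_nat_add of_nat_Suc)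
  then obtain l where l: "(\<lambda>n. (real (w n) + 1) / real n) \<longlonglongrightarrow> l"
    using subadditive_converges[of "\<lambda>n. real (w n) + 1"] by auto
  have inv: "(\<lambda>n. c / real n) \<longlonglongrightarrow> 0" for c :: real
    using tendsto_mult_left[OF lim_inverse_n', of c] by (simp add: field_simps)
  have l': "(\<lambda>n. real (w n) / real n) \<longlonglongrightarrow> l"
    using tendsto_diff[OF l inv[of 1]] by (simp flip: diff_divide_distrib)
  have "real (w n) / real n \<le> \<alpha> + C / real n" if "n > 0" for n
    using bound[OF that] W[OF that] that by (auto simp: field_simps)
  moreover have "(\<lambda>n. \<alpha> + C / real n) \<longlonglongrightarrow> \<alpha>" using tendsto_add[OF tendsto_const inv[of C]] by simp
  ultimately have "l \<le> \<alpha>"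
    using l' by (intro tendsto_le[OF trivial_limit_sequentially])
      (auto intro!: eventually_sequentiallyI[of 1])
  moreover have "0 \<le> l" using l' by (rule LIMSEQ_le_const) auto
  moreover have "(\<lambda>n. ereal_of_enat (W n) / ereal (real n)) \<longlonglongrightarrow> ereal l"
  proof (rule Lim_transform_eventually)
    show "(\<lambda>n. ereal (real (w n) / real n)) \<longlonglongrightarrow> ereal l" using l' by simp
    show "\<forall>\<^sub>F n in sequentially. ereal (real (w n) / real n) = ereal_of_enat (W n) / ereal (real n)"
      by (rule eventually_sequentiallyI[of 1]) (simp add: W)
  qed
  ultimately show ?thesis by blast
qed

text \<open>As \<epsilon> decreases to 0 an antitone function increases to its supremum.
  \<open>Lim\<close> is a definite description, so convergence has to be established before a bound
  can be derived.\<close>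

lemma Lim_at_right_antimono:
  fixes f :: "real \<Rightarrow> ereal"
  assumes anti: "\<And>a b. 0 < a \<Longrightarrow> a \<le> b \<Longrightarrow> f b \<le> f a"
    and bound: "\<And>a. 0 < a \<Longrightarrow> l \<le> f a \<and> f a \<le> u"
  shows "l \<le> Lim (at_right 0) f \<and> Lim (at_right 0) f \<le> u"
proof -
  define L where "L = (SUP a\<in>{0<..}. f a)"
  have "(f \<longlongrightarrow> L) (at_right 0)"
  proof (rule increasing_tendsto)
    show "\<forall>\<^sub>F a in at_right 0. f a \<le> L"
      unfolding eventually_at_right_field L_def by (intro exI[of _ 1]) (auto intro: SUP_upper)
    fix x assume "x < L"
    then obtain a where "a > 0" "x < f a" unfolding L_def less_SUP_iff by auto
    then show "\<forall>\<^sub>F b in at_right 0. x < f b"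
      unfolding eventually_at_right_field using anti by (intro exI[of _ a]) (auto intro: less_le_trans)
  qed
  then have "Lim (at_right 0) f = L" by (intro tendsto_Lim) auto
  moreover have "L \<le> u" unfolding L_def by (rule SUP_least) (use bound in auto)
  moreover have "l \<le> f 1" "f 1 \<le> L" using bound[of 1] by (auto simp: L_def intro: SUP_upper)
  ultimately show ?thesis by auto
qed

section \<open>The dynamical metrics and subadditivity of widths along orbits\<close>

lemma dyn_metric_le_iff:
  "n > 0 \<Longrightarrow> dyn_metric T d n x y \<le> e \<longleftrightarrow> (\<forall>i<n. d ((T ^^ i) x) ((T ^^ i) y) \<le> e)"
  unfolding dyn_metric_def by (subst Max_le_iff) auto

lemma le_dyn_metric: "i < n \<Longrightarrow> d ((T ^^ i) x) ((T ^^ i) y) \<le> dyn_metric T d n x y"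
  unfolding dyn_metric_def by (rule Max_ge) auto

lemma dyn_metric_mono: "0 < n \<Longrightarrow> n \<le> m \<Longrightarrow> dyn_metric T d n x y \<le> dyn_metric T d m x y"
  by (simp add: dyn_metric_le_iff le_dyn_metric)

lemma dyn_metric_funpow:
  "0 < m \<Longrightarrow> dyn_metric T d m ((T ^^ n) x) ((T ^^ n) y) \<le> dyn_metric T d (n + m) x y"
  unfolding dyn_metric_le_iff
  by (metis add.commute add_strict_left_mono comp_apply funpow_add le_dyn_metric)

lemma dyn_metric_add_le:
  assumes "0 < n" "0 < m"
  shows "dyn_metric T d (n + m) x y
           \<le> max (dyn_metric T d n x y) (dyn_metric T d m ((T ^^ n) x) ((T ^^ n) y))"
  unfolding dyn_metric_le_iff[OF add_pos_pos[OF assms]]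
proof (intro allI impI)
  fix i assume i: "i < n + m"
  show "d ((T ^^ i) x) ((T ^^ i) y)
          \<le> max (dyn_metric T d n x y) (dyn_metric T d m ((T ^^ n) x) ((T ^^ n) y))"
  proof (cases "i < n")
    case True then show ?thesis by (simp add: le_dyn_metric le_max_iff_disj)
  next
    case False
    then have "(T ^^ i) w = (T ^^ (i - n)) ((T ^^ n) w)" for w
      by (metis funpow_add comp_apply le_add_diff_inverse2 not_less)
    then show ?thesis using le_dyn_metric[of "i - n" m d T "(T ^^ n) x" "(T ^^ n) y"] False i
      by (auto simp: le_max_iff_disj)
  qed
qed

context Metric_space
begin

lemma Metric_space_dyn_metric:
  assumes T: "T ` M \<subseteq> M" and n: "n > 0"
  shows "Metric_space M (dyn_metric T d n)"
proof
  have Ti: "(T ^^ i) x \<in> M" if "x \<in> M" for x i using that T by (induction i) auto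
  fix x y
  show "0 \<le> dyn_metric T d n x y"
    using le_dyn_metric[of 0 n d T x y] n nonneg[of x y] by (simp del: nonneg)
  show "dyn_metric T d n x y = dyn_metric T d n y x" unfolding dyn_metric_def by (simp add: commute)
  show "dyn_metric T d n x y = 0 \<longleftrightarrow> x = y" if "x \<in> M" "y \<in> M"
  proof
    assume "dyn_metric T d n x y = 0"
    then show "x = y" using le_dyn_metric[of 0 n d T x y] n nonneg[of x y] that by simp
  next
    assume "x = y"
    then have "dyn_metric T d n x y \<le> 0" using n Ti that by (simp add: dyn_metric_le_iff)
    then show "dyn_metric T d n x y = 0"
      using le_dyn_metric[of 0 n d T x y] n nonneg[of x y] by (simp del: nonneg)
  qed
  fix z assume "x \<in> M" "y \<in> M" "z \<in> M"
  then have "d ((T ^^ i) x) ((T ^^ i) z) \<le> dyn_metric T d n x y + dyn_metric T d n y z" if "i < n" for i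
    using triangle[OF Ti Ti Ti, of x y z i i i] le_dyn_metric[OF that, of d T x y]
      le_dyn_metric[OF that, of d T y z] by linarith
  then show "dyn_metric T d n x z \<le> dyn_metric T d n x y + dyn_metric T d n y z"
    using n by (simp add: dyn_metric_le_iff)
qed

text \<open>The family has two uses: the whole space as its only member, and all fibres of a factor
  map, where \<open>s\<close> is the map downstairs and \<open>T\<close> carries the fibre over
  \<open>i\<close> into that over \<open>s i\<close>. The first \<open>n\<close> times are recorded
  by the identity, the next \<open>m\<close> by \<open>T ^^ n\<close>, and the join combines
  both.\<close>

lemma SUP_Widim_subadditive:
  fixes \<epsilon> :: real
  assumes T: "T ` M \<subseteq> M" and s: "s ` I \<subseteq> I"
    and Z: "\<And>i. i \<in> I \<Longrightarrow> Z i \<subseteq> M \<and> Z i \<noteq> {} \<and> T ` Z i \<subseteq> Z (s i)"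
    and nm: "n > 0" "m > 0"
  defines "W \<equiv> \<lambda>n. SUP i\<in>I. Widim \<epsilon> (Z i) (dyn_metric T d n)"
  shows "W (n + m) \<le> W n + W m + 1"
proof (cases "W n = \<infinity> \<or> W m = \<infinity>")
  case True then show ?thesis by auto
next
  case False
  then obtain D1 D2 where D: "W n = enat D1" "W m = enat D2" by auto
  have ms: "Metric_space (Z i) (dyn_metric T d k)" if "i \<in> I" "k > 0" for i k
    using Metric_space.subspace[OF Metric_space_dyn_metric[OF T that(2)]] Z[OF that(1)] by blast
  have it: "(s ^^ k) i \<in> I \<and> (T ^^ k) ` Z i \<subseteq> Z ((s ^^ k) i)" if "i \<in> I" for i k
  proof (induction k)
    case (Suc k) then show ?case using s Z[of "(s ^^ k) i"] by fastforce
  qed (use that in auto)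
  have "W (n + m) \<le> enat (D1 + D2 + 1)"
    unfolding W_def
  proof (rule SUP_least)
    fix i assume i: "i \<in> I"
    let ?j = "(s ^^ n) i"
    have j: "?j \<in> I" using it[OF i] by simp
    have "Widim \<epsilon> (Z i) (dyn_metric T d n) \<le> W n" "Widim \<epsilon> (Z ?j) (dyn_metric T d m) \<le> W m"
      unfolding W_def using i j by (auto intro: SUP_upper)
    then have le: "Widim \<epsilon> (Z i) (dyn_metric T d n) \<le> enat D1" "Widim \<epsilon> (Z ?j) (dyn_metric T d m) \<le> enat D2"
      unfolding D .
    show "Widim \<epsilon> (Z i) (dyn_metric T d (n + m)) \<le> enat (D1 + D2 + 1)"
      by (rule Widim_join[OF ms[OF i] ms[OF i] ms[OF j], where ?g1.0 = "\<lambda>x. x" and ?g2.0 = "T ^^ n", OF _ _ _ _ _ _ _ _ _ le])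
        (use nm it[OF i] Z[OF i] in \<open>simp_all add: dyn_metric_mono dyn_metric_funpow dyn_metric_add_le\<close>)
  qed
  then show ?thesis unfolding D by (simp add: one_enat_def)
qed

text \<open>Both mean dimensions are instances. The constant \<open>C\<close> may depend on
  \<epsilon> but is uniform in the index, since the supremum is taken before dividing by
  \<open>n\<close>.\<close>

lemma mean_Widim_le:
  assumes T: "T ` M \<subseteq> M" and I: "I \<noteq> {}" and s: "s ` I \<subseteq> I"
    and Z: "\<And>i. i \<in> I \<Longrightarrow> Z i \<subseteq> M \<and> Z i \<noteq> {} \<and> T ` Z i \<subseteq> Z (s i)"
    and bound: "\<And>\<epsilon>. \<epsilon> > 0 \<Longrightarrow> \<exists>C. \<forall>n>0. \<forall>i\<in>I. \<exists>D. Widim \<epsilon> (Z i) (dyn_metric T d n) \<le> enat D \<and>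
                real D \<le> \<alpha> * real n + C"
  defines "f \<equiv> \<lambda>\<epsilon>. lim (\<lambda>n. ereal_of_enat (SUP i\<in>I. Widim \<epsilon> (Z i) (dyn_metric T d n)) / ereal (real n))"
  shows "0 \<le> Lim (at_right 0) f \<and> Lim (at_right 0) f \<le> ereal \<alpha>"
proof -
  define W where "W \<epsilon> n = (SUP i\<in>I. Widim \<epsilon> (Z i) (dyn_metric T d n))" for \<epsilon> n
  have lim: "\<exists>l. 0 \<le> l \<and> l \<le> \<alpha> \<and> (\<lambda>n. ereal_of_enat (W \<epsilon> n) / ereal (real n)) \<longlonglongrightarrow> ereal l"
    if e: "\<epsilon> > 0" for \<epsilon>
  proof -
    obtain C where C: "\<And>n i. n > 0 \<Longrightarrow> i \<in> I \<Longrightarrow>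
        \<exists>D. Widim \<epsilon> (Z i) (dyn_metric T d n) \<le> enat D \<and> real D \<le> \<alpha> * real n + C"
      using bound[OF e] by blast
    show ?thesis
    proof (rule enat_subadditive_mean)
      show "W \<epsilon> (n + m) \<le> W \<epsilon> n + W \<epsilon> m + 1" if "n > 0" "m > 0" for n m
        unfolding W_def by (rule SUP_Widim_subadditive[where s = s and Z = Z, OF T s _ that]) (rule Z)
      show "\<exists>D. W \<epsilon> n \<le> enat D \<and> real D \<le> \<alpha> * real n + C" if n: "n > 0" for n
      proof (intro exI conjI)
        \<comment> \<open>Each index has its own \<open>D\<close>; the floor of the common bound
          serves all of them at once.\<close>
        have nn: "0 \<le> \<alpha> * real n + C" using C[OF n] I by (metis ex_in_conv of_nat_0_le_iff order_trans)
        then show "real (nat \<lfloor>\<alpha> * real n + C\<rfloor>) \<le> \<alpha> * real n + C" by linarith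
        show "W \<epsilon> n \<le> enat (nat \<lfloor>\<alpha> * real n + C\<rfloor>)" unfolding W_def
        proof (rule SUP_least)
          fix i assume "i \<in> I"
          then obtain D where D: "Widim \<epsilon> (Z i) (dyn_metric T d n) \<le> enat D" "real D \<le> \<alpha> * real n + C"
            using C[OF n] by blast
          then have "D \<le> nat \<lfloor>\<alpha> * real n + C\<rfloor>" by linarith
          then show "Widim \<epsilon> (Z i) (dyn_metric T d n) \<le> enat (nat \<lfloor>\<alpha> * real n + C\<rfloor>)"
            using D(1) by (meson enat_ord_simps(1) order_trans)
        qed
      qed
    qed
  qed
  have f: "(\<lambda>n. ereal_of_enat (W \<epsilon> n) / ereal (real n)) \<longlonglongrightarrow> f \<epsilon>" "0 \<le> f \<epsilon>" "f \<epsilon> \<le> ereal \<alpha>" if e: "\<epsilon> > 0" for \<epsilon>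
  proof -
    obtain l where l: "0 \<le> l" "l \<le> \<alpha>" "(\<lambda>n. ereal_of_enat (W \<epsilon> n) / ereal (real n)) \<longlonglongrightarrow> ereal l"
      using lim[OF e] by blast
    have "f \<epsilon> = ereal l" unfolding f_def using limI[OF l(3)] by (simp add: W_def)
    then show "(\<lambda>n. ereal_of_enat (W \<epsilon> n) / ereal (real n)) \<longlonglongrightarrow> f \<epsilon>" "0 \<le> f \<epsilon>" "f \<epsilon> \<le> ereal \<alpha>"
      using l by auto
  qed
  show ?thesis
  proof (rule Lim_at_right_antimono)
    fix a b :: real assume ab: "0 < a" "a \<le> b"
    have "W b n \<le> W a n" for n unfolding W_def by (intro SUP_mono') (rule Widim_mono_eps[OF ab(2)])
    then have "ereal_of_enat (W b n) / ereal (real n) \<le> ereal_of_enat (W a n) / ereal (real n)" if "n \<ge> 1" for n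
      using that by (intro ereal_divide_right_mono) auto
    then show "f b \<le> f a" using f(1)[of a] f(1)[of b] ab by (intro LIMSEQ_le) auto
  qed (use f in auto)
qed

end

section \<open>Combinatorics of one-dimensional power diagrams\<close>

text \<open>Division by \<open>L\<close> is injective on an \<open>L\<close>-separated set, and its
  values on \<open>A\<close> lie in an interval of at most \<open>(u - l) / L + 2\<close>
  integers.\<close>

lemma card_separated_le:
  fixes A :: "int set" and L :: nat
  assumes sub: "A \<subseteq> {l..u}" and L: "L > 0"
    and sep: "\<And>a b. a \<in> A \<Longrightarrow> b \<in> A \<Longrightarrow> a < b \<Longrightarrow> int L \<le> b - a"
    and lu: "l \<le> u"
  shows "real (card A) \<le> real_of_int (u - l) / real L + 2"
proof -
  have less: "a div int L < b div int L" if "a \<in> A" "b \<in> A" "a < b" for a b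
  proof -
    have "(a + int L) div int L \<le> b div int L" using sep[OF that] L by (intro zdiv_mono1) auto
    then show ?thesis using L by simp
  qed
  have inj: "inj_on (\<lambda>a. a div int L) A"
    by (rule inj_onI) (metis less linorder_neqE_linordered_idom order_less_irrefl)
  have "(\<lambda>a. a div int L) ` A \<subseteq> {l div int L..u div int L}"
    using sub L by (force intro!: zdiv_mono1)
  then have "card A \<le> card {l div int L..u div int L}"
    using card_mono[OF finite_atLeastAtMost_int] card_image[OF inj] by metis
  then have "int (card A) \<le> u div int L - l div int L + 1"
    using zdiv_mono1[OF lu, of "int L"] L by simp
  moreover have "real_of_int (u div int L) \<le> real_of_int u / real L"
    using real_of_int_div4[of u "int L"] by simp
  moreover have "real_of_int l / real L \<le> real_of_int (l div int L) + 1"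
    using real_of_int_div3[of l "int L"] by simp
  ultimately have "real (card A) \<le> real_of_int u / real L - real_of_int l / real L + 2" by linarith
  then show ?thesis by (simp add: diff_divide_distrib)
qed

text \<open>Source of the compression factor: at most one block set per cardinality is active, and
  only the cardinalities in one residue class count.\<close>

lemma card_mod_eq_le:
  fixes q m j :: nat
  assumes "m > 0"
  shows "real (card {k\<in>{1..q}. k mod m = j}) \<le> real q / real m + 1"
proof -
  have "inj_on (\<lambda>k. k div m) {k\<in>{1..q}. k mod m = j}"
    by (rule inj_onI) (metis (mono_tags, lifting) mem_Collect_eq div_mult_mod_eq)
  moreover have "(\<lambda>k. k div m) ` {k\<in>{1..q}. k mod m = j} \<subseteq> {..q div m}" by (auto intro: div_le_mono)
  ultimately have "card {k\<in>{1..q}. k mod m = j} \<le> card {..q div m}"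
    by (meson card_inj_on_le finite_atMost)
  then have "card {k\<in>{1..q}. k mod m = j} \<le> q div m + 1" by simp
  then have "real (card {k\<in>{1..q}. k mod m = j}) \<le> real (q div m) + 1" by linarith
  also have "\<dots> \<le> real q / real m + 1" by (simp add: of_nat_div_le_of_nat)
  finally show ?thesis .
qed

text \<open>The integer \<open>a\<close> carries the weight \<open>c a\<close>; its cell consists of the times \<open>t\<close> at which
  \<open>score c a t\<close> is maximal. The quadratic term makes the cell boundaries move continuously with
  the weights.\<close>

definition score :: "(int \<Rightarrow> real) \<Rightarrow> int \<Rightarrow> int \<Rightarrow> real" where
  "score c a t = c a - (real_of_int (t - a))\<^sup>2"

text \<open>A lead of 1, rather than any positive lead, makes the truncated factors of the margin
  exactly 1. Times without such a winner are the contested ones.\<close>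

definition wins :: "(int \<Rightarrow> real) \<Rightarrow> int \<Rightarrow> int \<Rightarrow> bool" where
  "wins c a t \<longleftrightarrow> 1 \<le> score c a t \<and> (\<forall>b. b \<noteq> a \<longrightarrow> score c b t + 1 \<le> score c a t)"

lemma score_pos_near:
  fixes B :: nat
  assumes "c a < (real B)\<^sup>2" "0 < score c a t"
  shows "\<bar>t - a\<bar> < int B"
proof -
  have "(real_of_int (t - a))\<^sup>2 < (real B)\<^sup>2" using assms by (simp add: score_def)
  then have "\<bar>real_of_int (t - a)\<bar> < real B"
    using power2_less_imp_less[of "\<bar>real_of_int (t - a)\<bar>" "real B"] by (simp del: of_int_diff)
  then show ?thesis by linarith
qed

text \<open>All scores are parabolas of the same curvature, so two of them differ by an affine
  function of time, of slope at least 2 in absolute value. A lead below 2 is therefore lost in one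
  step towards the rival.\<close>

lemma score_less_Suc:
  assumes "a < b" "score c a t < score c b t + 2"
  shows "score c a (t + 1) < score c b (t + 1)"
proof -
  have eq: "score c b (t + 1) - score c a (t + 1) = score c b t - score c a t + 2 * (real_of_int b - real_of_int a)"
    by (simp add: score_def power2_eq_square algebra_simps)
  have "1 \<le> real_of_int b - real_of_int a" using assms(1) by linarith
  with eq assms(2) show ?thesis by argo
qed

lemma score_less_pred:
  assumes "b < a" "score c a t < score c b t + 2"
  shows "score c a (t - 1) < score c b (t - 1)"
proof -
  have eq: "score c b (t - 1) - score c a (t - 1) = score c b t - score c a t + 2 * (real_of_int a - real_of_int b)"
    by (simp add: score_def power2_eq_square algebra_simps)
  have "1 \<le> real_of_int a - real_of_int b" using assms(1) by linarith
  with eq assms(2) show ?thesis by argo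
qed

text \<open>The best centre moves monotonically with time. If its lead at \<open>t\<close> is below
  1, one step towards the rival changes the best centre, so every contested time is next to a jump.
  Jumps are counted by the separated centres, and the factor 2 stands for the two sides of a
  jump.\<close>

lemma card_contested_le:
  fixes c :: "int \<Rightarrow> real" and B n L :: nat
  assumes L: "L > 0" and c: "\<And>a. c a < (real B)\<^sup>2"
    and cover: "\<And>t. \<exists>a. 1 \<le> score c a t"
    and sep: "\<And>a b. 0 < c a \<Longrightarrow> 0 < c b \<Longrightarrow> a < b \<Longrightarrow> int L \<le> b - a"
  shows "real (card {t\<in>{0..<int n}. \<nexists>a. wins c a t}) \<le> 2 * (real (n + 2 * B + 1) / real L + 2)"
proof -
  have near: "\<bar>t - a\<bar> < int B" if "0 < score c a t" for a t by (rule score_pos_near[OF c that])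
  have "\<exists>a. \<forall>b. score c b t \<le> score c a t" for t
  proof -
    \<comment> \<open>Only centres within \<open>B\<close> of \<open>t\<close> score positively, so
      the maximum is taken over a finite nonempty set.\<close>
    let ?S = "{a. 1 \<le> score c a t}"
    have "\<bar>t - a\<bar> < int B" if "a \<in> ?S" for a using near[of a t] that by simp
    then have "?S \<subseteq> {t - int B..t + int B}" by fastforce
    then have "finite ?S" by (rule finite_subset) simp
    moreover have "?S \<noteq> {}" using cover by auto
    ultimately obtain a where "is_arg_min (\<lambda>a. - score c a t) (\<lambda>a. a \<in> ?S) a"
      using ex_is_arg_min_if_finite[of ?S "\<lambda>a. - score c a t"] by blast
    then have a: "a \<in> ?S" "\<And>b. b \<in> ?S \<Longrightarrow> score c b t \<le> score c a t"
      by (auto simp: is_arg_min_linorder)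
    have "score c b t \<le> score c a t" for b
      using a by (cases "b \<in> ?S") (auto intro: order_trans)
    then show ?thesis by blast
  qed
  then obtain w where w: "\<And>t b. score c b t \<le> score c (w t) t" by metis
  have w1: "1 \<le> score c (w t) t" for t using cover[of t] w[where t = t] order_trans by blast
  have wpos: "0 < c (w t)" for t using w1[of t] zero_le_power2[of "real_of_int (t - w t)"]
    unfolding score_def by linarith
  have wnear: "\<bar>t - w t\<bar> < int B" for t using near[of "w t" t] w1[of t] by linarith
  have mono1: "w t \<le> w (t + 1)" for t
  proof (rule ccontr)
    assume "\<not> w t \<le> w (t + 1)"
    then have "score c (w (t + 1)) (t + 1) < score c (w t) (t + 1)"
      using w[of "w (t + 1)" t] by (intro score_less_Suc) auto
    then show False using w[of "w t" "t + 1"] by linarith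
  qed
  have mono: "w t \<le> w t'" if "t \<le> t'" for t t'
    using that by (induction t' rule: int_ge_induct) (auto intro: order_trans mono1)
  \<comment> \<open>Starting at -1 catches the jump just before time 0, which occurs when the rival
    lies to the left.\<close>
  define J where "J = {t\<in>{-1..<int n}. w t < w (t + 1)}"
  have finJ: "finite J" unfolding J_def by (rule finite_subset[of _ "{-1..<int n}"]) auto
  have wJ: "w t < w t'" if "t \<in> J" "t' \<in> J" "t < t'" for t t'
    using that mono[of "t + 1" t'] by (auto simp: J_def)
  have "inj_on w J" by (rule inj_onI) (metis wJ linorder_neqE_linordered_idom order_less_irrefl)
  then have "card J = card (w ` J)" by (simp add: card_image)
  moreover have "w ` J \<subseteq> {-1 - int B..int n + int B}" 
  proof (rule image_subsetI)
    fix t assume "t \<in> J"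
    then show "w t \<in> {-1 - int B..int n + int B}"
      using wnear[of t] unfolding J_def atLeastAtMost_iff mem_Collect_eq by auto
  qed
  then have "real (card (w ` J)) \<le> real_of_int (int n + int B - (-1 - int B)) / real L + 2"
    by (rule card_separated_le[OF _ L]) (auto intro!: sep wpos)
  ultimately have cJ: "real (card J) \<le> real (n + 2 * B + 1) / real L + 2" by (simp add: algebra_simps)
  have "{t\<in>{0..<int n}. \<nexists>a. wins c a t} \<subseteq> J \<union> (\<lambda>t. t + 1) ` J"
  proof clarsimp
    fix t assume t: "0 \<le> t" "t < int n" "\<forall>a. \<not> wins c a t" "t \<notin> (\<lambda>t. t + 1) ` J"
    then obtain b where b: "b \<noteq> w t" "score c (w t) t < score c b t + 1"
      using w1[of t] unfolding wins_def by (metis not_le)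
    have "b > w t"
    proof (rule ccontr)
      assume "\<not> b > w t"
      then have "b < w t" using b(1) by simp
      then have "score c (w t) (t - 1) < score c b (t - 1)"
        using b(2) by (intro score_less_pred) auto
      then have "w (t - 1) \<noteq> w t" using w[of b "t - 1"] by auto
      then have "t - 1 \<in> J" using mono1[of "t - 1"] t by (simp add: J_def)
      then show False using t(4) by (metis diff_add_cancel imageI)
    qed
    then have "score c (w t) (t + 1) < score c b (t + 1)"
      using b(2) by (intro score_less_Suc) auto
    then have "w (t + 1) \<noteq> w t" using w[of b "t + 1"] by auto
    then show "t \<in> J" using mono1[of t] t by (simp add: J_def)
  qed
  then have "card {t\<in>{0..<int n}. \<nexists>a. wins c a t} \<le> card J + card J"
    using card_mono[of "J \<union> (\<lambda>t. t + 1) ` J"] finJ card_Un_le[of J "(\<lambda>t. t + 1) ` J"]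
      card_image_le[OF finJ, of "\<lambda>t. t + 1"] by (meson add_left_mono finite_UnI finite_imageI order_trans)
  then have "real (card {t\<in>{0..<int n}. \<nexists>a. wins c a t}) \<le> 2 * real (card J)" by linarith
  also have "\<dots> \<le> 2 * (real (n + 2 * B + 1) / real L + 2)" using cJ by (intro mult_left_mono) auto
  finally show ?thesis .
qed

section \<open>Gaps in the decreasing arrangement of finitely many numbers\<close>

text \<open>\<open>gap E u S\<close> is positive iff \<open>S\<close> consists of the \<open>card S\<close> largest values, all of them positive,
  with a strict drop after them; so for each cardinality at most one \<open>S\<close> has positive gap.\<close>

definition gap :: "'e set \<Rightarrow> ('e \<Rightarrow> real) \<Rightarrow> 'e set \<Rightarrow> real" where
  "gap E u S = (\<Prod>e\<in>S. u e * (\<Prod>e'\<in>E - S. max 0 (u e - u e')))"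

lemma gap_nonneg: "(\<And>e. e \<in> S \<Longrightarrow> 0 \<le> u e) \<Longrightarrow> 0 \<le> gap E u S"
  unfolding gap_def by (intro prod_nonneg mult_nonneg_nonneg ballI) auto

lemma gap_pos_iff:
  assumes "finite E" "S \<subseteq> E" "\<And>e. e \<in> E \<Longrightarrow> 0 \<le> u e"
  shows "0 < gap E u S \<longleftrightarrow> (\<forall>e\<in>S. 0 < u e \<and> (\<forall>e'\<in>E - S. u e' < u e))"
proof -
  have fin: "finite S" "finite (E - S)" using assms finite_subset by auto
  have "0 < gap E u S \<longleftrightarrow> gap E u S \<noteq> 0"
    using gap_nonneg[of S u E] assms by (auto simp: less_le)
  also have "\<dots> \<longleftrightarrow> (\<forall>e\<in>S. u e \<noteq> 0 \<and> (\<forall>e'\<in>E - S. max 0 (u e - u e') \<noteq> 0))"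
    unfolding gap_def using fin by simp
  also have "\<dots> \<longleftrightarrow> (\<forall>e\<in>S. 0 < u e \<and> (\<forall>e'\<in>E - S. u e' < u e))"
  proof -
    have "u e \<noteq> 0 \<longleftrightarrow> 0 < u e" if "e \<in> S" for e using assms that by force
    moreover have "max 0 (u e - u e') \<noteq> 0 \<longleftrightarrow> u e' < u e" for e e' by auto
    ultimately show ?thesis by simp
  qed
  finally show ?thesis .
qed

lemma gap_unique:
  assumes "finite E" "S \<subseteq> E" "S' \<subseteq> E" "card S = card S'" "\<And>e. e \<in> E \<Longrightarrow> 0 \<le> u e"
    and "0 < gap E u S" "0 < gap E u S'"
  shows "S = S'"
proof (rule ccontr)
  assume "S \<noteq> S'"
  have fin: "finite S" "finite S'" using finite_subset[OF _ assms(1)] assms(2,3) by auto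
  have "\<not> S \<subseteq> S'" "\<not> S' \<subseteq> S"
    using \<open>S \<noteq> S'\<close> card_subset_eq[OF fin(2)] card_subset_eq[OF fin(1)] assms(4) by metis+
  then obtain e e' where e: "e \<in> S - S'" "e' \<in> S' - S" by blast
  then have "u e' < u e" "u e < u e'"
    using assms gap_pos_iff[of E S u] gap_pos_iff[of E S' u] by auto
  then show False by simp
qed

text \<open>This is how a positive gap reveals an active bump: whichever nonempty set has the
  positive gap, it contains every entry of maximal value.\<close>

lemma gap_contains_max:
  assumes "finite E" "S \<subseteq> E" "S \<noteq> {}" "\<And>e. e \<in> E \<Longrightarrow> 0 \<le> u e" "0 < gap E u S"
    and "e \<in> E" "\<And>e'. e' \<in> E \<Longrightarrow> u e' \<le> u e"
  shows "e \<in> S"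
proof (rule ccontr)
  assume "e \<notin> S"
  obtain s where s: "s \<in> S" using assms by auto
  have "u e < u s" using gap_pos_iff[of E S u] assms s \<open>e \<notin> S\<close> by auto
  then show False using assms(7)[of s] s assms(2) by force
qed

text \<open>Provides an active set: the values drop strictly from the positive ones to 0.\<close>

lemma gap_support_pos:
  assumes "finite E" "\<And>e. e \<in> E \<Longrightarrow> 0 \<le> u e"
  shows "0 < gap E u {e\<in>E. 0 < u e}"
  using assms by (subst gap_pos_iff) force+

lemma continuous_map_gap:
  assumes "finite E" "S \<subseteq> E" "\<And>e. e \<in> E \<Longrightarrow> continuous_map X euclideanreal (u e)"
  shows "continuous_map X euclideanreal (\<lambda>x. gap E (\<lambda>e. u e x) S)"
  unfolding gap_def
  using assms finite_subset[OF assms(2,1)]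
  by (intro continuous_map_prod continuous_map_real_mult continuous_map_real_max continuous_map_diff) auto

section \<open>Compact metric dynamical systems\<close>

lemma inj_on_funpow_carrier:
  "f ` A \<subseteq> A \<Longrightarrow> inj_on f A \<Longrightarrow> inj_on (f ^^ n) A"
proof (induction n)
  case (Suc n)
  then have "inj_on (f ^^ n) (f ` A)" by (meson inj_on_subset)
  then show ?case unfolding funpow_Suc_right using Suc.prems(2) by (intro comp_inj_on)
qed simp

locale compact_dynamics = Metric_space M d for M :: "'a set" and d +
  fixes T :: "'a \<Rightarrow> 'a"
  assumes compact: "compact_space mtopology" and homeomorphic: "homeomorphic_map mtopology mtopology T"
begin

abbreviation it :: "int \<Rightarrow> 'a \<Rightarrow> 'a" where "it \<equiv> int_iterate mtopology T"

abbreviation cont :: "('a \<Rightarrow> real) \<Rightarrow> bool" where "cont \<equiv> continuous_map mtopology euclideanreal"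

lemma T_inj: "inj_on T M" and T_surj: "T ` M = M"
  using homeomorphic_imp_injective_map[OF homeomorphic] homeomorphic_imp_surjective_map[OF homeomorphic]
  by simp_all

lemma it_of_nat: "it (int n) = T ^^ n" by (simp add: int_iterate_def)

lemma it_0 [simp]: "it 0 x = x" by (simp add: int_iterate_def)

lemma inv_T: "x \<in> M \<Longrightarrow> inv_into M T x \<in> M \<and> T (inv_into M T x) = x"
  using T_surj by (metis inv_into_into f_inv_into_f)

lemma continuous_it: "continuous_map mtopology mtopology (it n)"
proof -
  have pow: "continuous_map mtopology mtopology (f ^^ k)" if "continuous_map mtopology mtopology f" for f and k :: nat
  proof (induction k)
    case 0 then show ?case by (simp add: id_def)
  next
    case (Suc k) then show ?case using that by (simp only: funpow.simps(2)) (rule continuous_map_compose)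
  qed
  obtain g where g: "homeomorphic_maps mtopology mtopology T g"
    using homeomorphic homeomorphic_map_maps by blast
  have "g x = inv_into M T x" if "x \<in> M" for x
  proof -
    have "g x \<in> M" "T (g x) = x" using g that by (auto simp: homeomorphic_maps_def continuous_map_def)
    then show ?thesis using inv_into_f_f[OF T_inj] by metis
  qed
  then have "continuous_map mtopology mtopology (inv_into M T)"
    using continuous_map_eq[of mtopology mtopology g] g by (simp add: homeomorphic_maps_def)
  moreover have "continuous_map mtopology mtopology T" by (rule homeomorphic_imp_continuous_map[OF homeomorphic])
  ultimately show ?thesis unfolding int_iterate_def by (simp add: pow)
qed

lemma it_in [simp]: "x \<in> M \<Longrightarrow> it n x \<in> M"
  using continuous_it[of n] by (auto simp: continuous_map_def)

lemma it_Suc: assumes "x \<in> M" shows "it (n + 1) x = T (it n x)"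
proof (cases "n \<ge> 0")
  case True then show ?thesis by (simp add: int_iterate_def nat_add_distrib)
next
  case False
  then have "nat (- n) = Suc (nat (- n - 1))" by simp
  then have "it n x = inv_into M T (it (n + 1) x)" using False by (auto simp: int_iterate_def)
  then show ?thesis using inv_T[OF it_in[OF assms]] by metis
qed

lemma it_funpow: "x \<in> M \<Longrightarrow> (T ^^ k) (it n x) = it (int k + n) x"
proof (induction k)
  case (Suc k) then show ?case using it_Suc[of x "int k + n"] by (simp add: algebra_simps)
qed simp

text \<open>For negative \<open>m\<close> the two sides agree after applying
  \<open>T ^^ nat (- m)\<close>, which is injective on \<open>M\<close>.\<close>

lemma it_it: assumes "x \<in> M" shows "it m (it n x) = it (m + n) x"
proof (cases "m \<ge> 0")
  case True then show ?thesis using it_funpow[OF assms, of "nat m" n] it_of_nat[of "nat m"] by simp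
next
  case False
  then have "(T ^^ nat (- m)) (it m (it n x)) = (T ^^ nat (- m)) (it (m + n) x)"
    using assms by (simp add: it_funpow)
  then show ?thesis
    by (rule inj_onD[OF inj_on_funpow_carrier[OF equalityD1[OF T_surj] T_inj]]) (use assms in simp_all)
qed

lemma cont_it: "cont f \<Longrightarrow> cont (\<lambda>x. f (it n x))"
  using continuous_map_compose[OF continuous_it] by (force simp: o_def)

lemma cont_dist: assumes a: "a \<in> M" shows "cont (d a)"
proof -
  have "dist (d a x) (d a y) \<le> d x y" if "x \<in> M" "y \<in> M" for x y
    using triangle[OF a that] triangle[OF a that(2,1)] commute[of x y] by (simp add: dist_real_def abs_le_iff)
  then show ?thesis
    using continuous_map_lipschitz[OF Metric_space_axioms Met_TC.Metric_space_axioms, of "d a"]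
    by (simp add: mtopology_is_euclidean)
qed

lemma cont_bounded: assumes "cont f" shows "\<exists>b>0. \<forall>x\<in>M. f x < b"
proof -
  have "compactin euclideanreal (f ` M)"
    using image_compactin[OF _ assms, of M] compact by (simp add: compact_space_def)
  then have "bounded (f ` M)" by (simp add: compact_imp_bounded)
  then obtain b where "\<And>x. x \<in> M \<Longrightarrow> norm (f x) \<le> b" unfolding bounded_iff by blast
  then show ?thesis by (intro exI[of _ "\<bar>b\<bar> + 1"]) force
qed

lemma cont_openin: "cont f \<Longrightarrow> openin mtopology {x\<in>M. r < f x}"
  using openin_continuous_map_preimage[of mtopology euclideanreal f "{r<..}"] by simp

text \<open>Built on an \<open>e / 2\<close>-net: \<open>\<psi> v\<close> is 1 within
  \<open>e / 2\<close> of \<open>v\<close> and 0 beyond \<open>e\<close>. Reaching the largest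
  possible value 1 is what later forces the corresponding entry into every active set.\<close>

lemma finite_bumps:
  assumes "e > 0"
  obtains V \<psi> where "finite V" "V \<subseteq> M" "\<forall>v\<in>V. cont (\<psi> v)"
    "\<forall>v x. 0 \<le> \<psi> v x" "\<forall>v x. \<psi> v x \<le> 1"
    "\<forall>x\<in>M. \<exists>v\<in>V. \<psi> v x = 1" "\<forall>v x. (0::real) < \<psi> v x \<longrightarrow> d v x < e"
proof -
  have "mtotally_bounded M" using compact compact_space_eq_mcomplete_mtotally_bounded by blast
  then obtain V where V: "finite V" "V \<subseteq> M" "M \<subseteq> (\<Union>x\<in>V. mball x (e / 2))"
    unfolding mtotally_bounded_def using assms by (meson half_gt_zero)
  define \<psi> where "\<psi> v x = max 0 (min 1 (2 - 2 / e * d v x))" for v x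
  have "\<exists>v\<in>V. \<psi> v x = 1" if x: "x \<in> M" for x
  proof -
    obtain v where "v \<in> V" "d v x < e / 2" using V(3) x by (auto simp: mball_def)
    then show ?thesis using assms by (intro bexI[of _ v]) (auto simp: \<psi>_def field_simps)
  qed
  moreover have "d v x < e" if "0 < \<psi> v x" for v x
  proof -
    have "0 < 2 - 2 / e * d v x" using that unfolding \<psi>_def by (simp add: less_max_iff_disj)
    then show ?thesis using assms by (simp add: field_simps)
  qed
  moreover have "cont (\<psi> v)" if "v \<in> V" for v
    unfolding \<psi>_def using cont_dist[of v] that V(2)
    by (intro continuous_map_real_max continuous_map_real_min continuous_map_diff continuous_map_real_mult) auto
  moreover have "0 \<le> \<psi> v x" "\<psi> v x \<le> 1" for v x by (simp_all add: \<psi>_def)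
  ultimately show ?thesis using V(1,2) by (intro that[of V \<psi>]) blast+
qed

text \<open>A function that is positive only inside the marker set has separated positive times.
  Compactness leaves finitely many entrance times, so a large multiple exceeds
  \<open>1 + n^2\<close> at some entrance time \<open>n\<close>. At every time some centre then
  scores at least 1, and the power diagram covers the orbit.\<close>

lemma marker_function:
  assumes marker: "marker_property mtopology T" and L: "L > 0"
  obtains \<phi> and B :: nat where "cont \<phi>" "\<forall>x\<in>M. 0 \<le> \<phi> x \<and> \<phi> x < (real B)\<^sup>2"
    "\<forall>x\<in>M. \<forall>a b. 0 < \<phi> (it a x) \<longrightarrow> 0 < \<phi> (it b x) \<longrightarrow> a < b \<longrightarrow> int L \<le> b - a"
    "\<forall>x\<in>M. \<exists>n. 1 + (real_of_int n)\<^sup>2 \<le> \<phi> (it n x)"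
proof -
  obtain U where "openin mtopology U \<and> (\<forall>n. 0 < n \<and> n < int L \<longrightarrow> U \<inter> it n ` U = {}) \<and>
      topspace mtopology = (\<Union>n. it n ` U)"
    using marker L unfolding marker_property_def by (elim allE impE exE)
  then have U: "openin mtopology U" "\<And>n. 0 < n \<Longrightarrow> n < int L \<Longrightarrow> U \<inter> it n ` U = {}"
    and cover: "M = (\<Union>n. it n ` U)" by auto
  have UM: "U \<subseteq> M" using openin_subset[OF U(1)] by simp
  have "\<exists>n r. 0 < r \<and> mball (it n x) r \<subseteq> U" if "x \<in> M" for x
  proof -
    obtain n u where u: "u \<in> U" "x = it n u" using cover \<open>x \<in> M\<close> by blast
    then have "it (- n) x = u" using UM it_it[of u "- n" n] by auto
    then show ?thesis using u(1) U(1) unfolding openin_mtopology by metis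
  qed
  then obtain k r where kr: "\<And>x. x \<in> M \<Longrightarrow> 0 < r x \<and> mball (it (k x) x) (r x) \<subseteq> U" by metis
  define f where "f x y = max 0 (r x - d (it (k x) x) y)" for x y
  have f0: "0 \<le> f x y" for x y by (simp add: f_def)
  have fU: "y \<in> U" if "0 < f x y" "x \<in> M" "y \<in> M" for x y
    using kr[OF that(2)] that by (auto simp: f_def mball_def split: if_splits)
  have contf: "cont (f x)" if "x \<in> M" for x
    unfolding f_def using cont_dist[OF it_in[OF that]]
    by (intro continuous_map_real_max continuous_map_diff) auto
  define O' where "O' x = {y\<in>M. r x / 2 < f x (it (k x) y)}" for x
  have "openin mtopology (O' x)" if "x \<in> M" for x
    unfolding O'_def by (rule cont_openin[OF cont_it[OF contf[OF that]]])
  then have "\<forall>W\<in>O' ` M. openin mtopology W" by blast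
  moreover have "M \<subseteq> \<Union>(O' ` M)" using kr by (force simp: O'_def f_def)
  ultimately obtain \<F> where \<F>: "finite \<F>" "\<F> \<subseteq> O' ` M" "M \<subseteq> \<Union>\<F>"
    using compact unfolding compact_space_alt topspace_mtopology by metis
  then obtain F where F: "finite F" "F \<subseteq> M" "\<F> = O' ` F" by (meson finite_subset_image)
  \<comment> \<open>The sum dominates each of its terms; the 2 compensates for the threshold
    \<open>r x / 2\<close> in \<open>O'\<close>.\<close>
  define R where "R = (\<Sum>x\<in>F. 2 * (1 + (real_of_int (k x))\<^sup>2) / r x)"
  define \<phi> where "\<phi> y = (\<Sum>x\<in>F. R * f x y)" for y
  have terms: "0 \<le> 2 * (1 + (real_of_int (k x))\<^sup>2) / r x" if "x \<in> F" for x
    using kr[of x] that F(2) by (auto intro!: divide_nonneg_pos add_nonneg_nonneg)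
  have R0: "0 \<le> R" unfolding R_def by (intro sum_nonneg terms)
  have contphi: "cont \<phi>" unfolding \<phi>_def
    using F contf by (intro continuous_map_sum continuous_map_real_mult) auto
  have phi0: "0 \<le> \<phi> y" for y unfolding \<phi>_def using R0 f0 by (intro sum_nonneg) auto
  have phiU: "y \<in> U" if "0 < \<phi> y" "y \<in> M" for y
  proof -
    have "\<exists>x\<in>F. R * f x y \<noteq> 0" using that(1) unfolding \<phi>_def by (metis less_irrefl sum.neutral)
    then obtain x where "x \<in> F" "f x y \<noteq> 0" by auto
    then have "x \<in> F" "0 < f x y" using f0[of x y] by linarith+
    then show ?thesis using fU that F(2) by blast
  qed
  have sep: "int L \<le> b - a" if x: "x \<in> M" and ab: "0 < \<phi> (it a x)" "0 < \<phi> (it b x)" "a < b" for x a b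
  proof (rule ccontr)
    assume "\<not> int L \<le> b - a"
    then have "U \<inter> it (b - a) ` U = {}" using ab(3) by (intro U(2)) auto
    moreover have "it (b - a) (it a x) = it b x" using x by (simp add: it_it)
    then have "it b x \<in> it (b - a) ` U" using phiU[OF ab(1)] x by (metis imageI it_in)
    ultimately show False using phiU[OF ab(2)] x by auto
  qed
  have big: "\<exists>n. 1 + (real_of_int n)\<^sup>2 \<le> \<phi> (it n y)" if y: "y \<in> M" for y
  proof -
    obtain x where x: "x \<in> F" "r x / 2 < f x (it (k x) y)" using \<F>(3) F(3) y by (auto simp: O'_def)
    have rx: "0 < r x" using kr x(1) F(2) by auto
    have "1 + (real_of_int (k x))\<^sup>2 = (2 * (1 + (real_of_int (k x))\<^sup>2) / r x) * (r x / 2)" using rx by simp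
    also have "\<dots> \<le> R * f x (it (k x) y)"
    proof (rule mult_mono)
      show "2 * (1 + (real_of_int (k x))\<^sup>2) / r x \<le> R"
        unfolding R_def using terms F(1) x(1) by (intro member_le_sum) auto
    qed (use x R0 rx in auto)
    also have "\<dots> \<le> \<phi> (it (k x) y)"
      unfolding \<phi>_def using F(1) x(1) R0 f0 by (intro member_le_sum) auto
    finally show ?thesis by blast
  qed
  obtain b where b: "b > 0" "\<And>x. x \<in> M \<Longrightarrow> \<phi> x < b" using cont_bounded[OF contphi] by blast
  \<comment> \<open>A square bounding the weights makes \<open>B\<close> a bound for the radius of
    the cells.\<close>
  obtain B :: nat where B: "b \<le> real B" using real_arch_simple by blast
  have "real B \<le> (real B)\<^sup>2" by (simp add: power2_eq_square flip: of_nat_mult)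
  then have "0 \<le> \<phi> x \<and> \<phi> x < (real B)\<^sup>2" if "x \<in> M" for x using b(2)[OF that] B phi0[of x] by linarith
  then show ?thesis using contphi sep big by (intro that[of \<phi> B]) blast+
qed

end

section \<open>Encoding orbit segments by few functions\<close>

definition unit_clamp :: "real \<Rightarrow> real" where "unit_clamp r = max 0 (min 1 r)"

lemma unit_clamp_bounds: "0 \<le> unit_clamp r" "unit_clamp r \<le> 1" by (simp_all add: unit_clamp_def)
lemma unit_clamp_pos_iff: "0 < unit_clamp r \<longleftrightarrow> 0 < r" by (auto simp: unit_clamp_def less_max_iff_disj)
lemma unit_clamp_eq_1: "1 \<le> r \<Longrightarrow> unit_clamp r = 1" by (simp add: unit_clamp_def)

locale coding = compact_dynamics M d T for M :: "'a set" and d T +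
  fixes \<phi> :: "'a \<Rightarrow> real" and B L :: nat and V :: "'a set" and \<psi> :: "'a \<Rightarrow> 'a \<Rightarrow> real" and e :: real
  assumes L: "L > 0" and cont_phi: "cont \<phi>"
    and phi: "\<And>x. x \<in> M \<Longrightarrow> 0 \<le> \<phi> x \<and> \<phi> x < (real B)\<^sup>2"
    and sep: "\<And>x a b. x \<in> M \<Longrightarrow> 0 < \<phi> (it a x) \<Longrightarrow> 0 < \<phi> (it b x) \<Longrightarrow> a < b \<Longrightarrow> int L \<le> b - a"
    and cover: "\<And>x. x \<in> M \<Longrightarrow> \<exists>n. 1 + (real_of_int n)\<^sup>2 \<le> \<phi> (it n x)"
    and V: "finite V" "V \<subseteq> M"
    and cont_psi: "\<And>v. v \<in> V \<Longrightarrow> cont (\<psi> v)"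
    and psi: "\<And>v x. 0 \<le> \<psi> v x" "\<And>v x. \<psi> v x \<le> 1"
    and psi_cover: "\<And>x. x \<in> M \<Longrightarrow> \<exists>v\<in>V. \<psi> v x = 1"
    and psi_small: "\<And>v x. 0 < \<psi> v x \<Longrightarrow> d v x < e"
begin

definition weight :: "'a \<Rightarrow> int \<Rightarrow> real" where "weight x a = \<phi> (it a x)"

text \<open>Truncated margin by which \<open>0\<close> beats its competitors at time \<open>t\<close> in the power diagram of
  the orbit of \<open>x\<close>.\<close>

definition margin :: "int \<Rightarrow> 'a \<Rightarrow> real" where
  "margin t x = unit_clamp (score (weight x) 0 t) *
     (\<Prod>b\<in>{- 2 * int B..2 * int B} - {0}. unit_clamp (score (weight x) 0 t - score (weight x) b t))"

text \<open>Times are relative to the marker; radius \<open>B\<close> is enough because a centre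
  scores positively only within distance \<open>B\<close>.\<close>

definition slots :: "(int \<times> 'a) set" where "slots = {- int B..int B} \<times> V"

definition entry :: "int \<times> 'a \<Rightarrow> 'a \<Rightarrow> real" where
  "entry s x = margin (fst s) x * \<psi> (snd s) (it (fst s) x)"

text \<open>The empty set is left out because its gap is an empty product, hence 1, which would make
  one residue class positive everywhere.\<close>

definition blocks :: "nat \<Rightarrow> nat \<Rightarrow> (int \<times> 'a) set set" where
  "blocks m j = {S. S \<subseteq> slots \<and> S \<noteq> {} \<and> card S mod Suc m = j}"

text \<open>Summing over all subsets gives continuity without naming the sets of largest entries; at
  any point at most one term per cardinality is nonzero.\<close>

definition enc :: "nat \<Rightarrow> nat \<Rightarrow> 'a \<Rightarrow> real" where
  "enc m j x = (\<Sum>S\<in>blocks m j. gap slots (\<lambda>s. entry s x) S)"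

lemma finite_slots: "finite slots" by (simp add: slots_def V)

lemma finite_blocks: "finite (blocks m j)"
  unfolding blocks_def by (rule finite_subset[of _ "Pow slots"]) (auto simp: finite_slots)

lemma margin_bounds: "0 \<le> margin t x" "margin t x \<le> 1"
proof -
  let ?P = "\<Prod>b\<in>{- 2 * int B..2 * int B} - {0}. unit_clamp (score (weight x) 0 t - score (weight x) b t)"
  have "0 \<le> ?P" "?P \<le> 1" by (auto intro!: prod_nonneg prod_le_1 simp: unit_clamp_bounds)
  then show "0 \<le> margin t x" "margin t x \<le> 1"
    unfolding margin_def by (simp_all add: unit_clamp_bounds mult_le_one)
qed

lemma entry_bounds: "0 \<le> entry s x" "entry s x \<le> 1"
  unfolding entry_def by (simp_all add: margin_bounds psi mult_le_one)

lemma weight_it: "x \<in> M \<Longrightarrow> weight (it a x) b = weight x (b + a)"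
  by (simp add: weight_def it_it)

lemma score_it: "x \<in> M \<Longrightarrow> score (weight (it a x)) b (t - a) = score (weight x) (b + a) t"
  by (simp add: score_def weight_it algebra_simps)

lemma weight_less: "x \<in> M \<Longrightarrow> weight x a < (real B)\<^sup>2"
  by (simp add: weight_def phi)

text \<open>Competitors farther than \<open>2 * int B\<close> from the centre cannot score
  positively where the centre does, so the finite product in \<open>margin\<close> already decides
  against all of them.\<close>

lemma margin_pos:
  assumes x: "x \<in> M" and pos: "0 < margin (t - a) (it a x)"
  shows "0 < score (weight x) a t" "b \<noteq> a \<Longrightarrow> score (weight x) b t < score (weight x) a t"
proof -
  let ?P = "\<Prod>b\<in>{- 2 * int B..2 * int B} - {0}. unit_clamp (score (weight x) a t - score (weight x) (b + a) t)"
  have eq: "margin (t - a) (it a x) = unit_clamp (score (weight x) a t) * ?P"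
    unfolding margin_def using x by (simp add: score_it)
  have "unit_clamp (score (weight x) a t) \<noteq> 0" "?P \<noteq> 0"
    using pos unfolding eq by (metis less_irrefl mult_zero_left, metis less_irrefl mult_zero_right)
  then show pos': "0 < score (weight x) a t"
    using unit_clamp_pos_iff unit_clamp_bounds by (metis less_le)
  assume ba: "b \<noteq> a"
  show "score (weight x) b t < score (weight x) a t"
  proof (cases "\<bar>b - a\<bar> \<le> 2 * int B")
    case True
    then have "b - a \<in> {- 2 * int B..2 * int B} - {0}" using ba by auto
    then have "unit_clamp (score (weight x) a t - score (weight x) (b - a + a) t) \<noteq> 0"
      using \<open>?P \<noteq> 0\<close> by (simp only: prod_zero_iff finite_Diff finite_atLeastAtMost_int) blast
    then have "0 < unit_clamp (score (weight x) a t - score (weight x) b t)"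
      using unit_clamp_bounds(1) by (metis diff_add_cancel less_le)
    then show ?thesis by (simp add: unit_clamp_pos_iff)
  next
    case False
    have "\<bar>t - a\<bar> < int B" by (rule score_pos_near[OF weight_less[OF x] pos'])
    then have "\<not> \<bar>t - b\<bar> < int B" using False by linarith
    then have "\<not> 0 < score (weight x) b t" using score_pos_near[of "weight x" b B t, OF weight_less[OF x]] by blast
    then show ?thesis using pos' by linarith
  qed
qed

lemma margin_eq_1:
  assumes x: "x \<in> M" and "wins (weight x) a t"
  shows "margin (t - a) (it a x) = 1"
proof -
  have "unit_clamp (score (weight x) a t) = 1"
    "unit_clamp (score (weight x) a t - score (weight x) (b + a) t) = 1" if "b \<noteq> 0" for b
    using assms(2) that unfolding wins_def by (auto intro!: unit_clamp_eq_1 simp: le_diff_eq add.commute)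
  then have "unit_clamp (score (weight x) a t) = 1"
    "\<And>b. b \<noteq> 0 \<Longrightarrow> unit_clamp (score (weight x) a t - score (weight x) (b + a) t) = 1"
    by (metis zero_neq_one)+
  then show ?thesis unfolding margin_def using x by (simp add: score_it)
qed

lemma cont_score: "cont (\<lambda>x. score (weight x) b t)"
  unfolding score_def weight_def using cont_it[OF cont_phi] by (intro continuous_map_diff) auto

lemma cont_unit_clamp: "cont f \<Longrightarrow> cont (\<lambda>x. unit_clamp (f x))"
  unfolding unit_clamp_def by (intro continuous_map_real_max continuous_map_real_min) auto

lemma cont_entry: "s \<in> slots \<Longrightarrow> cont (entry s)"
  unfolding entry_def margin_def
  by (intro continuous_map_real_mult continuous_map_prod cont_unit_clamp continuous_map_diff cont_score cont_it cont_psi)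
    (auto simp: slots_def)

lemma cont_gap: "S \<subseteq> slots \<Longrightarrow> cont (\<lambda>x. gap slots (\<lambda>s. entry s x) S)"
  by (rule continuous_map_gap) (auto simp: finite_slots cont_entry)

lemma cont_enc: "cont (enc m j)"
  unfolding enc_def by (intro continuous_map_sum finite_blocks cont_gap) (auto simp: blocks_def)

lemma gap_entry_nonneg: "0 \<le> gap slots (\<lambda>s. entry s x) S"
  by (rule gap_nonneg) (rule entry_bounds)

lemma enc_nonneg: "0 \<le> enc m j x"
  unfolding enc_def by (intro sum_nonneg gap_entry_nonneg)

lemma enc_pos_imp_gap_pos:
  assumes "0 < enc m j x"
  shows "\<exists>S\<in>blocks m j. 0 < gap slots (\<lambda>s. entry s x) S"
proof -
  have "\<exists>S\<in>blocks m j. gap slots (\<lambda>s. entry s x) S \<noteq> 0"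
    using assms unfolding enc_def by (metis less_irrefl sum.neutral)
  then show ?thesis using gap_entry_nonneg by (metis less_le)
qed

lemma gap_pos_imp_entry_pos:
  assumes "S \<subseteq> slots" "0 < gap slots (\<lambda>s. entry s x) S" "s \<in> S"
  shows "0 < entry s x"
  using gap_pos_iff[of slots S "\<lambda>s. entry s x"] assms finite_slots entry_bounds by blast

lemma entry_pos: "0 < entry s x \<Longrightarrow> 0 < margin (fst s) x \<and> 0 < \<psi> (snd s) (it (fst s) x)"
  unfolding entry_def using margin_bounds psi(1) by (metis less_le mult_zero_left mult_zero_right)

text \<open>The stored values are nonzero only at markers, hence at most once in \<open>L\<close>
  steps; this keeps the factor small.\<close>

lemma enc_pos_imp_phi_pos:
  assumes x: "x \<in> M" and "0 < enc m j x"
  shows "0 < \<phi> x"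
proof -
  obtain S where S: "S \<in> blocks m j" "0 < gap slots (\<lambda>s. entry s x) S"
    using enc_pos_imp_gap_pos[OF assms(2)] by blast
  then obtain s where "s \<in> S" "S \<subseteq> slots" by (auto simp: blocks_def)
  then have "0 < margin (fst s - 0) (it 0 x)" using gap_pos_imp_entry_pos S(2) entry_pos by auto
  then have "0 < score (weight x) 0 (fst s)" using margin_pos(1)[OF x] by blast
  then show ?thesis
    using zero_le_power2[of "real_of_int (fst s - 0)"] unfolding score_def weight_def it_0 by linarith
qed

text \<open>At a won time the margin is 1 and some bump is 1, so the set of positive entries is
  nonempty. It has a positive gap, and its cardinality selects the residue class.\<close>

lemma wins_imp_enc_pos:
  assumes x: "x \<in> M" and "wins (weight x) a t"
  shows "\<exists>j\<le>m. 0 < enc m j (it a x)"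
proof -
  let ?u = "\<lambda>s. entry s (it a x)"
  let ?S = "{s\<in>slots. 0 < ?u s}"
  obtain v where v: "v \<in> V" "\<psi> v (it t x) = 1" using psi_cover[OF it_in[OF x]] by blast
  have "0 < score (weight x) a t" using assms(2) by (simp add: wins_def)
  then have "\<bar>t - a\<bar> < int B" by (rule score_pos_near[OF weight_less[OF x]])
  then have "(t - a, v) \<in> slots" using v by (auto simp: slots_def)
  moreover have "?u (t - a, v) = 1" using margin_eq_1[OF assms] v x by (simp add: entry_def it_it)
  ultimately have "(t - a, v) \<in> ?S" by simp
  then have "?S \<noteq> {}" by blast
  then have S: "?S \<in> blocks m (card ?S mod Suc m)" by (auto simp: blocks_def)
  have "0 < gap slots ?u ?S" by (intro gap_support_pos finite_slots entry_bounds)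
  also have "\<dots> \<le> enc m (card ?S mod Suc m) (it a x)"
    unfolding enc_def by (rule member_le_sum[OF S gap_entry_nonneg finite_blocks])
  finally show ?thesis using mod_less_divisor[of "Suc m" "card ?S"] by (metis less_Suc_eq_le zero_less_Suc)
qed

text \<open>The coordinates are the gaps of each block, for one residue class only, and the raw
  bumps at contested times. The three terms of the bound count the compressed slots, the rounding
  excess of one per block, and all bumps at contested times; the summands with \<open>B\<close>
  account for blocks crossing the ends of the time window.\<close>

lemma Widim_fibre_le:
  assumes Z: "Z \<subseteq> M" "Z \<noteq> {}" and n: "n > 0" and eps: "2 * e < \<epsilon>"
    and phi_const: "\<And>x y a. x \<in> Z \<Longrightarrow> y \<in> Z \<Longrightarrow> \<phi> (it a x) = \<phi> (it a y)"
    and enc_const: "\<And>x y a j. x \<in> Z \<Longrightarrow> y \<in> Z \<Longrightarrow> j \<le> m \<Longrightarrow> enc m j (it a x) = enc m j (it a y)"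
  shows "\<exists>D. Widim \<epsilon> Z (dyn_metric T d n) \<le> enat D \<and>
    real D \<le> real (card V) * real (n + 4 * B + 1) / real (Suc m) + (real (n + 2 * B) / real L + 2) +
      real (card V) * (2 * (real (n + 2 * B + 1) / real L + 2))" (is "\<exists>D. _ \<and> _ \<le> ?bound")
proof -
  obtain x0 where x0: "x0 \<in> Z" "x0 \<in> M" using Z by auto
  \<comment> \<open>As \<phi> is constant on the fibre along orbits, all points of \<open>Z\<close>
    share one power diagram, which can be read off from \<open>x0\<close>.\<close>
  define c where "c = weight x0"
  have c: "weight x = c" if "x \<in> Z" for x
    unfolding c_def weight_def using phi_const[OF that x0(1)] by blast
  have margin_const: "margin t (it a x) = margin t (it a x0)" if "x \<in> Z" for t a x
  proof -
    have "weight (it a x) = weight (it a x0)"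
      using c[OF that] c[OF x0(1)] weight_it that x0(2) Z(1) by (intro ext) (metis subsetD)
    then show ?thesis by (simp add: margin_def)
  qed
  have cB: "c a < (real B)\<^sup>2" for a unfolding c_def by (rule weight_less[OF x0(2)])
  have csep: "int L \<le> b - a" if "0 < c a" "0 < c b" "a < b" for a b
    using sep[OF x0(2)] that unfolding c_def weight_def by blast
  define bad where "bad = {t\<in>{0..<int n}. \<nexists>a. wins c a t}"
  define A where "A = {a. \<exists>t\<in>{0..<int n}. wins c a t}"
  have near: "\<bar>t - a\<bar> < int B" if "0 < score c a t" for a t by (rule score_pos_near[OF cB that])
  have A_sub: "A \<subseteq> {- int B..int n + int B}"
  proof
    fix a assume "a \<in> A"
    then obtain t where "t \<in> {0..<int n}" "0 < score c a t" by (auto simp: A_def wins_def)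
    then show "a \<in> {- int B..int n + int B}" using near[of a t] by auto
  qed
  have finA: "finite A" using A_sub by (rule finite_subset) simp
  have finbad: "finite bad" unfolding bad_def by (rule finite_subset[of _ "{0..<int n}"]) auto
  have cpos: "0 < c a" if a: "a \<in> A" for a
  proof -
    obtain t where "1 \<le> score c a t" using a by (auto simp: A_def wins_def)
    then show ?thesis using zero_le_power2[of "real_of_int (t - a)"] unfolding score_def by linarith
  qed
  have card_A: "real (card A) \<le> real (n + 2 * B) / real L + 2"
  proof -
    have "real (card A) \<le> real_of_int (int n + int B - (- int B)) / real L + 2"
      by (rule card_separated_le[OF A_sub L]) (auto intro!: csep cpos)
    then show ?thesis by (simp add: algebra_simps)
  qed
  have card_bad: "real (card bad) \<le> 2 * (real (n + 2 * B + 1) / real L + 2)"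
    unfolding bad_def
  proof (rule card_contested_le[OF L cB])
    fix t
    obtain k where "1 + (real_of_int k)\<^sup>2 \<le> \<phi> (it k (it t x0))" using cover[OF it_in[OF x0(2)]] by blast
    then have "1 \<le> score c (k + t) t" using x0(2) by (simp add: score_def c_def weight_def it_it)
    then show "\<exists>a. 1 \<le> score c a t" by blast
  qed (rule csep)
  \<comment> \<open>For each block one residue class is positive at \<open>x0\<close>; constancy of
    \<open>enc\<close> on the fibre makes the same class work for every point of
    \<open>Z\<close>.\<close>
  have "\<exists>j\<le>m. 0 < enc m j (it a x0)" if "a \<in> A" for a
    using that wins_imp_enc_pos[OF x0(2)] by (auto simp: A_def c_def)
  then obtain jj where jj: "\<And>a. a \<in> A \<Longrightarrow> jj a \<le> m \<and> 0 < enc m (jj a) (it a x0)" by metis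
  \<comment> \<open>All times at which the block of \<open>a\<close> is visible, including its
    fading ends. These sets are disjoint for distinct centres, as only one centre can be
    ahead.\<close>
  define \<tau> where "\<tau> a = {t. 0 < margin (t - a) (it a x0)}" for a
  have tau_sub: "\<tau> a \<subseteq> {a - int B..a + int B}" for a
  proof
    fix t assume "t \<in> \<tau> a"
    then have "0 < score c a t" using margin_pos(1)[OF x0(2)] by (auto simp: \<tau>_def c_def)
    then show "t \<in> {a - int B..a + int B}" using near[of a t] by auto
  qed
  have fintau: "finite (\<tau> a)" for a using tau_sub by (rule finite_subset) simp
  have disj: "\<tau> a \<inter> \<tau> b = {}" if "a \<noteq> b" for a b
  proof (rule ccontr)
    assume "\<tau> a \<inter> \<tau> b \<noteq> {}"
    then obtain t where "0 < margin (t - a) (it a x0)" "0 < margin (t - b) (it b x0)" by (auto simp: \<tau>_def)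
    then have "score c b t < score c a t" "score c a t < score c b t"
      unfolding c_def using margin_pos(2)[OF x0(2)] that by metis+
    then show False by simp
  qed
  have sum_tau: "(\<Sum>a\<in>A. card (\<tau> a)) \<le> n + 4 * B + 1"
  proof -
    have "(\<Sum>a\<in>A. card (\<tau> a)) = card (\<Union>a\<in>A. \<tau> a)"
      using finA fintau disj by (intro card_UN_disjoint[symmetric]) auto
    \<comment> \<open>A centre lies within \<open>B\<close> of the window and its times within
      \<open>B\<close> of the centre, hence \<open>2 * B\<close> on either side.\<close>
    also have "\<dots> \<le> card {- 2 * int B..int n + 2 * int B}"
    proof (rule card_mono)
      show "(\<Union>a\<in>A. \<tau> a) \<subseteq> {- 2 * int B..int n + 2 * int B}"
      proof
        fix t assume "t \<in> (\<Union>a\<in>A. \<tau> a)"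
        then obtain a where "a \<in> {- int B..int n + int B}" "t \<in> {a - int B..a + int B}"
          using A_sub tau_sub by blast
        then show "t \<in> {- 2 * int B..int n + 2 * int B}" by auto
      qed
    qed simp
    also have "\<dots> = n + 4 * B + 1" by simp
    finally show ?thesis .
  qed
  define P where "P x a = {S \<in> blocks m (jj a). 0 < gap slots (\<lambda>s. entry s (it a x)) S}" for x a
  have card_P: "real (card (P x a)) \<le> real (card V) * real (card (\<tau> a)) / real (Suc m) + 1"
    if x: "x \<in> Z" for x a
  proof -
    \<comment> \<open>With at most one active set per cardinality, counting sets means counting
      cardinalities in one residue class.\<close>
    have inj: "inj_on card (P x a)"
      by (rule inj_onI, rule gap_unique[OF finite_slots, where u = "\<lambda>s. entry s (it a x)"])
        (auto simp: P_def blocks_def entry_bounds)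
    have "card ` P x a \<subseteq> {k \<in> {1..card V * card (\<tau> a)}. k mod Suc m = jj a}"
    proof (rule image_subsetI)
      fix S assume S: "S \<in> P x a"
      then have S': "S \<subseteq> slots" "S \<noteq> {}" "card S mod Suc m = jj a" by (auto simp: P_def blocks_def)
      have finS: "finite S" using S'(1) finite_slots finite_subset by blast
      have "S \<subseteq> (\<lambda>t. t - a) ` \<tau> a \<times> V"
      proof
        fix s assume s: "s \<in> S"
        then have "0 < margin (fst s) (it a x)"
          using gap_pos_imp_entry_pos[OF S'(1)] S entry_pos by (auto simp: P_def)
        then have "fst s + a \<in> \<tau> a" using margin_const[OF x] by (simp add: \<tau>_def)
        then have "fst s \<in> (\<lambda>t. t - a) ` \<tau> a" by (metis add_diff_cancel imageI)
        moreover have "snd s \<in> V" using s S'(1) by (auto simp: slots_def)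
        ultimately show "s \<in> (\<lambda>t. t - a) ` \<tau> a \<times> V" by (simp add: mem_Times_iff)
      qed
      then have "card S \<le> card ((\<lambda>t. t - a) ` \<tau> a \<times> V)" by (intro card_mono) (auto simp: fintau V)
      also have "\<dots> \<le> card (\<tau> a) * card V"
        unfolding card_cartesian_product by (intro mult_right_mono card_image_le fintau) auto
      finally show "card S \<in> {k \<in> {1..card V * card (\<tau> a)}. k mod Suc m = jj a}"
        using S'(2,3) finS by (auto simp: Suc_le_eq card_gt_0_iff mult.commute)
    qed
    then have "card (card ` P x a) \<le> card {k \<in> {1..card V * card (\<tau> a)}. k mod Suc m = jj a}"
      by (intro card_mono) auto
    then have "real (card (P x a)) \<le> real (card {k \<in> {1..card V * card (\<tau> a)}. k mod Suc m = jj a})"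
      unfolding card_image[OF inj] by simp
    also have "\<dots> \<le> real (card V * card (\<tau> a)) / real (Suc m) + 1" by (rule card_mod_eq_le) simp
    finally show ?thesis by simp
  qed
  define W where "W = (SIGMA a:A. blocks m (jj a)) <+> bad \<times> V"
  define h where "h w x = (case w of Inl (a, S) \<Rightarrow> gap slots (\<lambda>s. entry s (it a x)) S
                                   | Inr (t, v) \<Rightarrow> \<psi> v (it t x))" for w x
  have finW: "finite W" unfolding W_def using finA finite_blocks finbad V by auto
  have conth: "cont (h w)" if w: "w \<in> W" for w
  proof (cases w)
    case (Inl p)
    then obtain a S where "w = Inl (a, S)" "S \<subseteq> slots" using w by (cases p) (auto simp: W_def blocks_def)
    then show ?thesis using cont_it[OF cont_gap, of S a] by (simp add: h_def[abs_def])
  next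
    case (Inr p)
    then obtain t v where "w = Inr (t, v)" "v \<in> V" using w by (cases p) (auto simp: W_def)
    then show ?thesis using cont_it[OF cont_psi, of v t] by (simp add: h_def[abs_def])
  qed
  have nonneg_h: "0 \<le> h w x" for w x
    by (auto simp: h_def gap_entry_nonneg psi split: sum.split prod.split)
  \<comment> \<open>Each point has at each time a positive coordinate that confines all points
    sharing it: a bump itself if the time is contested, otherwise the gap of a set containing the
    slot of a bump with entry 1.\<close>
  have seen: "\<exists>w\<in>W. 0 < h w x \<and> (\<forall>y\<in>Z. 0 < h w y \<longrightarrow> d ((T ^^ i) x) ((T ^^ i) y) \<le> 2 * e)"
    if x: "x \<in> Z" and i: "i < n" for x i
  proof -
    define t where "t = int i"
    have t: "t \<in> {0..<int n}" using i by (simp add: t_def)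
    obtain v where v: "v \<in> V" "\<psi> v (it t x) = 1" using psi_cover[OF it_in] x Z(1) by blast
    have close: "d ((T ^^ i) x) ((T ^^ i) y) \<le> 2 * e" if y: "y \<in> Z" and "0 < \<psi> v (it t y)" for y
    proof -
      have "d v (it t x) < e" "d v (it t y) < e" using psi_small v(2) that by auto
      moreover have "it t x \<in> M" "it t y \<in> M" "v \<in> M" using x y Z V v by auto
      ultimately have "d (it t x) (it t y) \<le> 2 * e"
        using triangle[of "it t x" v "it t y"] commute[of "it t x" v] by simp
      then show ?thesis by (simp add: t_def it_of_nat)
    qed
    show ?thesis
    proof (cases "t \<in> bad")
      case True
      then have "Inr (t, v) \<in> W" using v by (auto simp: W_def)
      then show ?thesis using v close by (intro bexI[of _ "Inr (t, v)"]) (auto simp: h_def)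
    next
      case False
      then obtain a where a: "wins c a t" using t by (auto simp: bad_def)
      then have aA: "a \<in> A" using t by (auto simp: A_def)
      have xM: "x \<in> M" using x Z by auto
      have "0 < enc m (jj a) (it a x)" using jj[OF aA] enc_const[OF x x0(1)] by simp
      then obtain S where S: "S \<in> blocks m (jj a)" "0 < gap slots (\<lambda>s. entry s (it a x)) S"
        using enc_pos_imp_gap_pos by blast
      have S': "S \<subseteq> slots" "S \<noteq> {}" using S by (auto simp: blocks_def)
      have "\<bar>t - a\<bar> < int B" using near[of a t] a by (simp add: wins_def)
      then have slot: "(t - a, v) \<in> slots" using v by (auto simp: slots_def)
      have "margin (t - a) (it a x) = 1" using margin_eq_1[OF xM] a c[OF x] by simp
      then have "entry (t - a, v) (it a x) = 1" using v xM by (simp add: entry_def it_it)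
      then have inS: "(t - a, v) \<in> S"
        using gap_contains_max[OF finite_slots S' entry_bounds(1) S(2) slot] entry_bounds(2) by simp
      have "0 < \<psi> v (it t y)" if y: "y \<in> Z" and "0 < gap slots (\<lambda>s. entry s (it a y)) S" for y
      proof -
        have "0 < entry (t - a, v) (it a y)" using gap_pos_imp_entry_pos[OF S'(1) that(2) inS] .
        then have "0 < \<psi> v (it (t - a) (it a y))" using entry_pos by force
        then show ?thesis using it_it[of y "t - a" a] y Z(1) by auto
      qed
      moreover have "Inl (a, S) \<in> W" using aA S by (auto simp: W_def)
      ultimately show ?thesis using S(2) close by (intro bexI[of _ "Inl (a, S)"]) (auto simp: h_def)
    qed
  qed
  have card_h: "real (card {w\<in>W. 0 < h w x}) \<le> ?bound" if x: "x \<in> Z" for x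
  proof -
    have "{w\<in>W. 0 < h w x} \<subseteq> (SIGMA a:A. P x a) <+> bad \<times> V"
      by (auto simp: W_def h_def P_def)
    moreover have finP: "finite (P x a)" for a unfolding P_def using finite_blocks by auto
    ultimately have "card {w\<in>W. 0 < h w x} \<le> card ((SIGMA a:A. P x a) <+> bad \<times> V)"
      using finA finbad V by (intro card_mono) auto
    also have "\<dots> = (\<Sum>a\<in>A. card (P x a)) + card bad * card V"
      using finA finbad V finP by (simp add: card_Plus card_cartesian_product)
    finally have "real (card {w\<in>W. 0 < h w x}) \<le> (\<Sum>a\<in>A. real (card (P x a))) + real (card bad) * real (card V)"
      by (simp flip: of_nat_sum of_nat_mult of_nat_add)
    also have "(\<Sum>a\<in>A. real (card (P x a))) \<le> (\<Sum>a\<in>A. real (card V) * real (card (\<tau> a)) / real (Suc m) + 1)"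
      by (intro sum_mono card_P x)
    also have "\<dots> = real (card V) / real (Suc m) * real (\<Sum>a\<in>A. card (\<tau> a)) + real (card A)"
      by (simp add: sum.distrib sum_distrib_left)
    also have "\<dots> \<le> real (card V) / real (Suc m) * real (n + 4 * B + 1) + (real (n + 2 * B) / real L + 2)"
      by (intro add_mono mult_left_mono card_A of_nat_mono sum_tau) auto
    also have "real (card bad) * real (card V) \<le> 2 * (real (n + 2 * B + 1) / real L + 2) * real (card V)"
      by (intro mult_right_mono card_bad) auto
    finally show ?thesis by (simp add: mult.commute)
  qed
  define D where "D = nat \<lfloor>?bound\<rfloor>"
  have ms: "Metric_space Z (dyn_metric T d n)"
    using Metric_space.subspace[OF Metric_space_dyn_metric[OF _ n] Z(1)] T_surj by simp
  have incl: "continuous_map (Metric_space.mtopology Z (dyn_metric T d n)) mtopology (\<lambda>x. x)"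
    by (rule continuous_map_lipschitz[OF ms Metric_space_axioms]) (use Z le_dyn_metric[of 0 n d T] n in auto)
  have "Widim \<epsilon> Z (dyn_metric T d n) \<le> enat D"
  proof (rule Widim_le_support[OF ms Z(2) finW _ nonneg_h _ _ _ eps])
    show "continuous_map (Metric_space.mtopology Z (dyn_metric T d n)) euclideanreal (h w)" if "w \<in> W" for w
      using continuous_map_compose[OF incl conth[OF that]] by (simp add: o_def)
    show "\<exists>w\<in>W. 0 < h w x" if "x \<in> Z" for x using seen[OF that n] by blast
    show "card {w\<in>W. 0 < h w x} \<le> Suc D" if "x \<in> Z" for x
      using card_h[OF that] unfolding D_def by linarith
    show "dyn_metric T d n x y \<le> 2 * e" if "x \<in> Z" "y \<in> Z" "\<And>w. w \<in> W \<Longrightarrow> 0 < h w x \<longleftrightarrow> 0 < h w y" for x y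
      unfolding dyn_metric_le_iff[OF n] using seen[OF that(1)] that by blast
  qed
  moreover have "real D \<le> ?bound"
    unfolding D_def using card_h[OF x0(1)] by linarith
  ultimately show ?thesis by blast
qed

end

section \<open>One stage of the construction: sparse functions with thin fibres at a given
  scale\<close>

context compact_dynamics
begin

text \<open>The same \<alpha> bounds the cost to the factor, \<open>J / L\<close>, and the mean
  width left on the fibres. A summable sequence of such \<alpha> thus makes the product of the
  stages small and its fibres thin.\<close>

lemma sparse_encoding:
  assumes marker: "marker_property mtopology T" and pos: "0 < \<epsilon>" "0 < \<alpha>"
    and z: "z \<in> M" "z' \<in> M" "z \<noteq> z'"
  shows "\<exists>(L::nat) (J::nat) g. L > 0 \<and> real J \<le> \<alpha> * real L \<and>
    (\<forall>j<J. cont (g j) \<and> (\<forall>x\<in>M. 0 \<le> g j x)) \<and>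
    (\<forall>i<J. \<forall>j<J. \<forall>x\<in>M. \<forall>a b. 0 < g i (it a x) \<longrightarrow> 0 < g j (it b x) \<longrightarrow> a < b \<longrightarrow> int L \<le> b - a) \<and>
    (\<exists>j<J. \<exists>a. g j (it a z) \<noteq> g j (it a z')) \<and>
    (\<exists>C. \<forall>n>0. \<forall>Z. Z \<subseteq> M \<longrightarrow> Z \<noteq> {} \<longrightarrow>
       (\<forall>j<J. \<forall>a. \<forall>x\<in>Z. \<forall>y\<in>Z. g j (it a x) = g j (it a y)) \<longrightarrow>
       (\<exists>D. Widim \<epsilon> Z (dyn_metric T d n) \<le> enat D \<and> real D \<le> \<alpha> * real n + C))"
proof -
  define e where "e = \<epsilon> / 3"
  have e: "0 < e" "2 * e < \<epsilon>" using pos by (auto simp: e_def)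
  obtain V \<psi> where V: "finite V" "V \<subseteq> M" "\<forall>v\<in>V. cont (\<psi> v)"
    "\<forall>v x. 0 \<le> \<psi> v x" "\<forall>v x. \<psi> v x \<le> 1"
    "\<forall>x\<in>M. \<exists>v\<in>V. \<psi> v x = 1" "\<forall>v x. (0::real) < \<psi> v x \<longrightarrow> d v x < e"
    by (rule finite_bumps[OF e(1)], rule that)
  define N where "N = card V"
  \<comment> \<open>Makes \<open>N / (m + 1)\<close> at most \<open>\<alpha> / 2\<close>;
    \<open>N\<close> is already fixed by the bumps.\<close>
  obtain m :: nat where m: "2 * real N / \<alpha> \<le> real m" using real_arch_simple by blast
  \<comment> \<open>The first summand makes \<open>(1 + 2 * N) / L\<close> at most
    \<open>\<alpha> / 2\<close>, the second gives \<open>J \<le> \<alpha> * L\<close> with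
    \<open>J = m + 3\<close>, and the last keeps \<open>L\<close> positive.\<close>
  obtain L :: nat where Lge: "2 * (1 + 2 * real N) / \<alpha> + real (m + 3) / \<alpha> + 1 \<le> real L" using real_arch_simple by blast
  have q: "0 \<le> 2 * (1 + 2 * real N) / \<alpha>" "0 \<le> real (m + 3) / \<alpha>" using pos by auto
  have Lpos: "L > 0" using Lge q by (cases L) auto
  obtain \<phi> and B :: nat where ph: "cont \<phi>" "\<forall>x\<in>M. 0 \<le> \<phi> x \<and> \<phi> x < (real B)\<^sup>2"
    "\<forall>x\<in>M. \<forall>a b. 0 < \<phi> (it a x) \<longrightarrow> 0 < \<phi> (it b x) \<longrightarrow> a < b \<longrightarrow> int L \<le> b - a"
    "\<forall>x\<in>M. \<exists>n. 1 + (real_of_int n)\<^sup>2 \<le> \<phi> (it n x)"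
    by (rule marker_function[OF marker Lpos], rule that)
  note ph = ph(1) ph(2-4)[rule_format]
  interpret coding M d T \<phi> B L V \<psi> e
    by (unfold_locales; fact Lpos ph V[rule_format])
  obtain k where k: "1 + (real_of_int k)\<^sup>2 \<le> \<phi> (it k z)" using ph(4)[OF z(1)] by blast
  have kpos: "0 < \<phi> (it k z)" using k zero_le_power2[of "real_of_int k"] by linarith
  \<comment> \<open>Time \<open>k\<close> is a marker of \<open>z\<close>. The function
    \<open>\<phi> x * d w x\<close> vanishes at \<open>it k z'\<close> and is positive at
    \<open>it k z\<close>; the factor \<phi> keeps it sparse.\<close>
  define w where "w = it k z'"
  have wM: "w \<in> M" using z by (simp add: w_def)
  have neq: "it k z \<noteq> w"
  proof
    assume "it k z = w"
    then have "it (- k) (it k z) = it (- k) (it k z')" by (simp add: w_def)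
    then show False using z by (simp add: it_it)
  qed
  \<comment> \<open>These are \<phi> itself, so that a fibre shares one tiling, the function
    separating the two points, and \<open>m + 1\<close> values of \<open>enc\<close>.\<close>
  define J where "J = m + 3"
  define g where "g j x = (if j = 0 then \<phi> x else if j = 1 then \<phi> x * d w x else enc m (j - 2) x)" for j x
  have g_pos: "0 < \<phi> x" if "x \<in> M" "0 < g j x" for j x
  proof -
    have "0 < \<phi> x" if "0 < \<phi> x * d w x" using that nonneg[of w x] by (simp add: zero_less_mult_iff)
    then show ?thesis using that enc_pos_imp_phi_pos[of x m "j - 2"] by (auto simp: g_def split: if_splits)
  qed
  have contg: "cont (g j)" for j
  proof -
    have "cont (\<lambda>x. \<phi> x * d w x)" using ph(1) cont_dist[OF wM] by (rule continuous_map_real_mult)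
    then show ?thesis using ph(1) cont_enc[of m "j - 2"] by (cases "j = 0"; cases "j = 1") (simp_all add: g_def[abs_def] cong: if_cong)
  qed
  have g0: "0 \<le> g j x" if "x \<in> M" for j x using ph(2)[OF that] enc_nonneg by (simp add: g_def)
  have gsep: "int L \<le> b - a" if "x \<in> M" "0 < g i (it a x)" "0 < g j (it b x)" "a < b" for i j x a b
    using ph(3)[OF that(1) g_pos g_pos that(4)] that by simp
  have gz: "g 1 (it k z) \<noteq> g 1 (it k z')"
  proof -
    have "0 < d w (it k z)" using neq wM z by auto
    moreover have "d w (it k z') = 0" using wM by (simp add: w_def[symmetric])
    ultimately show ?thesis using kpos by (simp add: g_def)
  qed
  have JL: "real J \<le> \<alpha> * real L"
  proof -
    have "real (m + 3) / \<alpha> \<le> real L" using Lge q by linarith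
    then show ?thesis using pos by (simp add: J_def field_simps)
  qed
    define C where "C = real N * real (4 * B + 1) / real (Suc m) + (real (2 * B) / real L + 2) +
      real N * (2 * (real (2 * B + 1) / real L + 2))"
    have fib: "\<exists>D. Widim \<epsilon> Z (dyn_metric T d n) \<le> enat D \<and> real D \<le> \<alpha> * real n + C"
      if n: "n > 0" and Z: "Z \<subseteq> M" "Z \<noteq> {}"
        and const: "\<And>j a x y. j < J \<Longrightarrow> x \<in> Z \<Longrightarrow> y \<in> Z \<Longrightarrow> g j (it a x) = g j (it a y)" for n Z
    proof -
      have "\<phi> (it a x) = \<phi> (it a y)" if "x \<in> Z" "y \<in> Z" for x y a
        using const[of 0 x y a] that by (simp add: g_def J_def)
      moreover have "enc m j (it a x) = enc m j (it a y)" if "x \<in> Z" "y \<in> Z" "j \<le> m" for x y a j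
        using const[of "j + 2" x y a] that by (simp add: g_def J_def)
      ultimately obtain D where D: "Widim \<epsilon> Z (dyn_metric T d n) \<le> enat D"
        "real D \<le> real N * real (n + 4 * B + 1) / real (Suc m) + (real (n + 2 * B) / real L + 2) +
          real N * (2 * (real (n + 2 * B + 1) / real L + 2))"
        using Widim_fibre_le[OF Z n e(2), of m] unfolding N_def by blast
      note D(2)
      also have "real N * real (n + 4 * B + 1) / real (Suc m) + (real (n + 2 * B) / real L + 2) +
          real N * (2 * (real (n + 2 * B + 1) / real L + 2))
        = real N / real (Suc m) * real n + (1 + 2 * real N) / real L * real n + C"
        by (simp add: C_def add_divide_distrib algebra_simps)
      also have "\<dots> \<le> \<alpha> / 2 * real n + \<alpha> / 2 * real n + C"
      proof (intro add_mono mult_right_mono)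
        have "2 * real N / \<alpha> \<le> real (Suc m)" using m by simp
        then show "real N / real (Suc m) \<le> \<alpha> / 2" using pos by (simp add: field_simps)
        have "2 * (1 + 2 * real N) / \<alpha> \<le> real L" using Lge q by linarith
        then show "(1 + 2 * real N) / real L \<le> \<alpha> / 2" using pos Lpos by (simp add: field_simps)
      qed auto
      finally show ?thesis using D(1) by auto
    qed
  have J1: "1 < J" by (simp add: J_def)
  show ?thesis
  proof (rule exI[of _ L], rule exI[of _ J], rule exI[of _ g], intro conjI)
    show "\<forall>j<J. cont (g j) \<and> (\<forall>x\<in>M. 0 \<le> g j x)" using contg g0 by simp
    show "\<forall>i<J. \<forall>j<J. \<forall>x\<in>M. \<forall>a b. 0 < g i (it a x) \<longrightarrow> 0 < g j (it b x) \<longrightarrow> a < b \<longrightarrow> int L \<le> b - a"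
      using gsep by simp
    show "\<exists>j<J. \<exists>a. g j (it a z) \<noteq> g j (it a z')" using J1 gz by auto
    show "\<exists>C. \<forall>n>0. \<forall>Z. Z \<subseteq> M \<longrightarrow> Z \<noteq> {} \<longrightarrow>
       (\<forall>j<J. \<forall>a. \<forall>x\<in>Z. \<forall>y\<in>Z. g j (it a x) = g j (it a y)) \<longrightarrow>
       (\<exists>D. Widim \<epsilon> Z (dyn_metric T d n) \<le> enat D \<and> real D \<le> \<alpha> * real n + C)"
      by (intro exI[of _ C] allI impI fib) blast+
  qed (fact Lpos JL)+
qed

end

section \<open>Factors given by sparse sequences of functions\<close>

text \<open>Tent of height 1 centred at \<open>l * \<eta>\<close>. Only indices
  \<open>l \<ge> 1\<close> are used, so no tent is positive at 0 and a vanishing coordinate costs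
  nothing.\<close>

definition hat :: "real \<Rightarrow> nat \<Rightarrow> real \<Rightarrow> real" where
  "hat \<eta> l r = max 0 (1 - \<bar>r / \<eta> - real l\<bar>)"

lemma hat_pos_iff: "0 < hat \<eta> l r \<longleftrightarrow> \<bar>r / \<eta> - real l\<bar> < 1"
  by (auto simp: hat_def less_max_iff_disj)

lemma card_hat_pos:
  assumes "0 < \<eta>" "0 \<le> r"
  shows "card {l\<in>{1..K}. 0 < hat \<eta> l r} \<le> (if 0 < r then 2 else 0)"
proof (cases "0 < r")
  case True
  define q where "q = nat \<lfloor>r / \<eta>\<rfloor>"
  have "real q \<le> r / \<eta>" "r / \<eta> < real q + 1"
    unfolding q_def using assms by auto
  then have "{l\<in>{1..K}. 0 < hat \<eta> l r} \<subseteq> {q, Suc q}"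
    unfolding hat_pos_iff by (auto simp: abs_less_iff)
  then have "card {l\<in>{1..K}. 0 < hat \<eta> l r} \<le> card {q, Suc q}" by (intro card_mono) auto
  then show ?thesis using True by simp
next
  case False
  then have "r = 0" using assms by simp
  then have "{l\<in>{1..K}. 0 < hat \<eta> l r} = {}" by (auto simp: hat_pos_iff)
  then show ?thesis by (simp only: card.empty)
qed

text \<open>A positive value lies under some tent in range, and by equal supports the other value
  lies under the same tent. If neither is positive, both are 0.\<close>

lemma hat_support_close:
  assumes eta: "0 < \<eta>" and r: "0 \<le> r" "r \<le> \<eta> * real K" "0 \<le> r'" "r' \<le> \<eta> * real K"
    and same: "\<And>l. l \<in> {1..K} \<Longrightarrow> 0 < hat \<eta> l r \<longleftrightarrow> 0 < hat \<eta> l r'"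
  shows "\<bar>r - r'\<bar> < 2 * \<eta>"
proof -
  have meets: "\<exists>l\<in>{1..K}. 0 < hat \<eta> l s" if s: "0 < s" "s \<le> \<eta> * real K" for s
  proof -
    have q: "0 < s / \<eta>" "s / \<eta> \<le> real K" using s eta by (auto simp: field_simps)
    define l where "l = nat \<lceil>s / \<eta>\<rceil>"
    have l: "s / \<eta> \<le> real l" "real l < s / \<eta> + 1" unfolding l_def using q(1) by linarith+
    then have "0 < l" using q(1) by (cases l) auto
    moreover have "l \<le> K" unfolding l_def using q(2) by (simp add: nat_le_iff ceiling_le_iff)
    ultimately show ?thesis using l by (intro bexI[of _ l]) (auto simp: hat_pos_iff)
  qed
  have "\<bar>r - r'\<bar> < 2 * \<eta>" if "0 < hat \<eta> l r" "0 < hat \<eta> l r'" for l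
  proof -
    have "\<bar>r / \<eta> - r' / \<eta>\<bar> < 2" using that unfolding hat_pos_iff by linarith
    then have "\<bar>(r - r') / \<eta>\<bar> < 2" by (simp add: diff_divide_distrib)
    then show ?thesis using eta by (simp add: abs_divide field_simps)
  qed
  note close = this
  show ?thesis
  proof (cases "0 < r \<or> 0 < r'")
    case True
    then obtain l where "0 < hat \<eta> l r" "0 < hat \<eta> l r'"
      using meets[of r] meets[of r'] same r by blast
    then show ?thesis by (rule close)
  next
    case False
    then have "r = 0" "r' = 0" using r by auto
    then show ?thesis using eta by simp
  qed
qed

section \<open>Compact subsets of a countable product of lines\<close>

lemma continuous_map_coordinate:
  "continuous_map (subtopology (powertop_real UNIV) A) euclideanreal (\<lambda>x. x c)"
  using continuous_map_product_projection[of c UNIV "\<lambda>_. euclideanreal"]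
  by (intro continuous_map_from_subtopology) simp

text \<open>The metric is an arbitrary compatible one, so its uniform size is read off from the
  topology: basic neighbourhoods depend on finitely many coordinates, and compactness makes the
  choice uniform. Radius \<open>2 * \<eta>\<close> against \<eta> in the cover leaves room for the
  triangle inequality.\<close>

lemma finite_coordinates_control:
  fixes A :: "(nat \<Rightarrow> real) set"
  assumes ms: "Metric_space A \<rho>" and top: "Metric_space.mtopology A \<rho> = subtopology (powertop_real UNIV) A"
    and cpt: "compact_space (subtopology (powertop_real UNIV) A)" and eps: "0 < \<epsilon>"
  shows "\<exists>F \<eta>. finite F \<and> 0 < \<eta> \<and> (\<forall>y\<in>A. \<forall>y'\<in>A. (\<forall>c\<in>F. \<bar>y c - y' c\<bar> < \<eta>) \<longrightarrow> \<rho> y y' < \<epsilon>)"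
proof -
  interpret Metric_space A \<rho> by fact
  have "\<exists>F \<eta>. finite F \<and> 0 < \<eta> \<and> (\<forall>y'\<in>A. (\<forall>c\<in>F. \<bar>y c - y' c\<bar> < 2 * \<eta>) \<longrightarrow> \<rho> y y' < \<epsilon> / 2)" if y: "y \<in> A" for y
  proof -
    have "openin (subtopology (powertop_real UNIV) A) (mball y (\<epsilon> / 2))" using openin_mball top by metis
    then obtain W where W: "openin (powertop_real UNIV) W" "mball y (\<epsilon> / 2) = W \<inter> A"
      unfolding openin_subtopology by blast
    have "y \<in> W" using W(2) y eps by (metis Int_iff centre_in_mball_iff half_gt_zero)
    then obtain X where X: "y \<in> (\<Pi>\<^sub>E i\<in>UNIV. X i)" "\<And>i. open (X i)" "finite {i. X i \<noteq> UNIV}" "(\<Pi>\<^sub>E i\<in>UNIV. X i) \<subseteq> W"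
      using product_topology_open_contains_basis[OF W(1), of y] by (simp only: open_openin[symmetric] topspace_euclidean) blast
    define F where "F = {i. X i \<noteq> UNIV}"
    have "\<exists>r>0. ball (y i) r \<subseteq> X i" for i using X(1,2) unfolding PiE_UNIV_domain by (meson Pi_mem UNIV_I open_contains_ball)
    then obtain r where r: "\<And>i. 0 < r i \<and> ball (y i) (r i) \<subseteq> X i" by metis
    define \<eta> where "\<eta> = Min (insert 1 (r ` F)) / 2"
    have finF: "finite F" using X(3) by (simp add: F_def)
    have eta: "0 < \<eta>" unfolding \<eta>_def using r finF by auto
    have close: "\<rho> y y' < \<epsilon> / 2" if y': "y' \<in> A" "\<And>c. c \<in> F \<Longrightarrow> \<bar>y c - y' c\<bar> < 2 * \<eta>" for y'
    proof -
      have "y' i \<in> X i" for i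
      proof (cases "i \<in> F")
        case True
        then have "2 * \<eta> \<le> r i" unfolding \<eta>_def using finF by simp
        then have "dist (y i) (y' i) < r i" using y'(2)[OF True] by (simp add: dist_real_def)
        then show ?thesis using r[of i] by auto
      qed (simp add: F_def)
      then have "y' \<in> mball y (\<epsilon> / 2)" using X(4) W(2) y'(1) by (auto simp: PiE_UNIV_domain)
      then show ?thesis by simp
    qed
    show ?thesis
      by (rule exI[of _ F], rule exI[of _ \<eta>], intro conjI ballI impI finF eta close) simp_all
  qed
  then obtain F \<eta> where F: "\<And>y. y \<in> A \<Longrightarrow> finite (F y) \<and> 0 < \<eta> y \<and>
      (\<forall>y'\<in>A. (\<forall>c\<in>F y. \<bar>y c - y' c\<bar> < 2 * \<eta> y) \<longrightarrow> \<rho> y y' < \<epsilon> / 2)" by metis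
  define O' where "O' y = {y'\<in>A. \<forall>c\<in>F y. \<bar>y c - y' c\<bar> < \<eta> y}" for y
  have "openin (subtopology (powertop_real UNIV) A) (O' y)" if y: "y \<in> A" for y
  proof -
    have "openin (subtopology (powertop_real UNIV) A) {y'\<in>topspace (subtopology (powertop_real UNIV) A). y' c \<in> ball (y c) (\<eta> y)}" for c
      by (rule openin_continuous_map_preimage[OF continuous_map_coordinate]) simp
    then have "openin (subtopology (powertop_real UNIV) A) (A \<inter> {y'. y' c \<in> ball (y c) (\<eta> y)})" for c
      by (simp add: Collect_conj_eq)
    then have "openin (subtopology (powertop_real UNIV) A)
        (topspace (subtopology (powertop_real UNIV) A) \<inter> \<Inter>((\<lambda>c. A \<inter> {y'. y' c \<in> ball (y c) (\<eta> y)}) ` F y))"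
      using F[OF y] by (intro openin_Int_Inter openin_topspace) auto
    also have "topspace (subtopology (powertop_real UNIV) A) \<inter> \<Inter>((\<lambda>c. A \<inter> {y'. y' c \<in> ball (y c) (\<eta> y)}) ` F y) = O' y"
      by (auto simp: O'_def dist_real_def)
    finally show ?thesis .
  qed
  then have "\<forall>W\<in>O' ` A. openin (subtopology (powertop_real UNIV) A) W" by blast
  moreover have "topspace (subtopology (powertop_real UNIV) A) \<subseteq> \<Union>(O' ` A)"
    using F by (auto simp: O'_def)
  ultimately obtain \<F> where \<F>: "finite \<F>" "\<F> \<subseteq> O' ` A" "topspace (subtopology (powertop_real UNIV) A) \<subseteq> \<Union>\<F>"
    using cpt[unfolded compact_space_alt, rule_format, of "O' ` A"] by auto
  then obtain Y where Y: "finite Y" "Y \<subseteq> A" "\<F> = O' ` Y" by (meson finite_subset_image)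
  define \<eta>0 where "\<eta>0 = Min (insert 1 (\<eta> ` Y))"
  have eta: "0 < \<eta>0" unfolding \<eta>0_def using Y F by auto
  have control: "\<rho> y y' < \<epsilon>" if y: "y \<in> A" "y' \<in> A" and close: "\<And>c. c \<in> \<Union>(F ` Y) \<Longrightarrow> \<bar>y c - y' c\<bar> < \<eta>0" for y y'
  proof -
    obtain w where w: "w \<in> Y" "y \<in> O' w" using \<F>(3) Y(3) y(1) by auto
    have wA: "w \<in> A" using w Y by auto
    have le: "\<eta>0 \<le> \<eta> w" unfolding \<eta>0_def using Y w by simp
    have c1: "\<bar>w c - y c\<bar> < \<eta> w" if "c \<in> F w" for c using w that by (auto simp: O'_def)
    have "\<bar>w c - y' c\<bar> < 2 * \<eta> w" if "c \<in> F w" for c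
      using c1[OF that] close[of c] that w le by fastforce
    moreover have "\<bar>w c - y c\<bar> < 2 * \<eta> w" if "c \<in> F w" for c
      using c1[OF that] F[OF wA] by linarith
    ultimately have "\<rho> w y < \<epsilon> / 2" "\<rho> w y' < \<epsilon> / 2" using F[OF wA] y by auto
    then show ?thesis using triangle[of y w y'] commute[of y w] y wA by simp
  qed
  have fin: "finite (\<Union>(F ` Y))" using Y F by auto
  show ?thesis
    by (rule exI[of _ "\<Union>(F ` Y)"], rule exI[of _ \<eta>0], intro conjI ballI impI fin eta control) blast+
qed

text \<open>Stage, function and time are packed into one number so that all stages live in a single
  countable product of lines.\<close>

definition key :: "nat \<Rightarrow> nat \<Rightarrow> int \<Rightarrow> nat" where
  "key p j s = prod_encode (p, prod_encode (j, int_encode s))"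

definition key_cases :: "(nat \<Rightarrow> nat \<Rightarrow> int \<Rightarrow> 'b) \<Rightarrow> nat \<Rightarrow> 'b" where
  "key_cases f c = (case prod_decode c of (p, r) \<Rightarrow> case prod_decode r of (j, i) \<Rightarrow> f p j (int_decode i))"

definition key_shift :: "nat \<Rightarrow> nat" where
  "key_shift = key_cases (\<lambda>p j s. key p j (s + 1))"

lemma key_cases_key [simp]: "key_cases f (key p j s) = f p j s"
  by (simp add: key_cases_def key_def)

lemma key_surj: "\<exists>p j s. c = key p j s"
  by (metis key_def prod_decode_inverse int_decode_inverse surj_pair)

lemma key_shift_key [simp]: "key_shift (key p j s) = key p j (s + 1)"
  by (simp add: key_shift_def)

lemma key_shift_funpow [simp]: "(key_shift ^^ i) (key p j s) = key p j (s + int i)"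
  by (induction i arbitrary: s) (simp_all add: funpow_Suc_right del: funpow.simps(2) add: algebra_simps)

text \<open>Every coordinate can still be read after a shift, which makes \<open>shift\<close>
  injective.\<close>

lemma surj_key_shift: "surj key_shift"
proof (rule surjI)
  fix c
  obtain p j s where "c = key p j s" using key_surj by blast
  then show "key_shift (key_cases (\<lambda>p j s. key p j (s - 1)) c) = c" by simp
qed

definition shift :: "(nat \<Rightarrow> real) \<Rightarrow> nat \<Rightarrow> real" where "shift y c = y (key_shift c)"

lemma shift_funpow: "(shift ^^ i) y c = y ((key_shift ^^ i) c)"
  by (induction i arbitrary: c) (simp_all add: shift_def funpow_swap1[of key_shift])

section \<open>The factor of itineraries and its mean dimension\<close>

context compact_dynamics
begin

text \<open>The itinerary of \<open>x\<close> under the functions of all stages. Coordinates with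
  \<open>j \<ge> J p\<close> hold the dummy value 0, so stages may differ in their number of
  functions.\<close>

definition code :: "(nat \<Rightarrow> nat) \<Rightarrow> (nat \<Rightarrow> nat \<Rightarrow> 'a \<Rightarrow> real) \<Rightarrow> 'a \<Rightarrow> nat \<Rightarrow> real" where
  "code J g x = key_cases (\<lambda>p j s. if j < J p then g p j (it s x) else 0)"

definition code_space :: "(nat \<Rightarrow> nat) \<Rightarrow> (nat \<Rightarrow> nat \<Rightarrow> 'a \<Rightarrow> real) \<Rightarrow> (nat \<Rightarrow> real) topology" where
  "code_space J g = subtopology (powertop_real UNIV) (code J g ` M)"

lemma code_key: "code J g x (key p j s) = (if j < J p then g p j (it s x) else 0)"
  by (simp add: code_def)

lemma topspace_code_space [simp]: "topspace (code_space J g) = code J g ` M"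
  by (simp add: code_space_def)

lemma shift_code: assumes x: "x \<in> M" shows "shift (code J g x) = code J g (T x)"
proof
  fix c
  obtain p j s where c: "c = key p j s" using key_surj by blast
  have "it (s + 1) x = it s (it 1 x)" using it_it[OF x] by simp
  moreover have "it 1 x = T x" using it_of_nat[of 1] by simp
  ultimately show "shift (code J g x) c = code J g (T x) c"
    by (simp add: c shift_def code_key)
qed

lemma shift_image: "shift ` (code J g ` M) = code J g ` M"
proof -
  have "shift ` (code J g ` M) = (\<lambda>x. code J g (T x)) ` M"
    unfolding image_image by (rule image_cong) (simp_all add: shift_code)
  also have "\<dots> = code J g ` (T ` M)" by (simp only: image_image)
  finally show ?thesis by (simp only: T_surj)
qed

text \<open>The image is compact and Hausdorff, which turns the continuous bijection
  \<open>shift\<close> on it into a homeomorphism.\<close>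

lemma code_factor:
  assumes cont: "\<And>p j. j < J p \<Longrightarrow> cont (g p j)"
  shows "tds (code_space J g) shift" "factor_map mtopology T (code_space J g) shift (code J g)"
proof -
  let ?Y = "code_space J g"
  have "cont (\<lambda>x. code J g x c)" for c
  proof -
    obtain p j s where c: "c = key p j s" using key_surj by blast
    show ?thesis unfolding c code_key using cont_it[OF cont, of j p s] by (cases "j < J p") auto
  qed
  then have pow: "continuous_map mtopology (powertop_real UNIV) (code J g)"
    unfolding continuous_map_componentwise_UNIV by auto
  then have cm: "continuous_map mtopology ?Y (code J g)"
    unfolding code_space_def by (simp add: continuous_map_into_subtopology)
  have "compactin (powertop_real UNIV) (code J g ` M)"
    using image_compactin[OF _ pow, of M] compact by (simp add: compact_space_def)
  then have cpt: "compact_space ?Y" unfolding code_space_def by (rule compact_space_subtopology)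
  have "metrizable_space (powertop_real (UNIV :: nat set))"
    by (simp add: metrizable_space_product_topology metrizable_space_euclidean)
  then have mtr: "metrizable_space ?Y" unfolding code_space_def by (rule metrizable_space_subtopology)
  note img = shift_image[of J g]
  have "continuous_map ?Y euclideanreal (\<lambda>y. shift y c)" for c
    unfolding shift_def code_space_def by (rule continuous_map_coordinate)
  then have "continuous_map ?Y (powertop_real UNIV) shift"
    unfolding continuous_map_componentwise_UNIV by auto
  then have cs: "continuous_map ?Y ?Y shift"
    unfolding code_space_def continuous_map_in_subtopology using img by auto
  have "inj shift"
  proof (rule injI, rule ext)
    fix y y' c assume eq: "shift y = shift y'"
    obtain c' where "c = key_shift c'" using surj_key_shift by (metis surjD)
    then show "y c = y' c" using fun_cong[OF eq, of c'] by (simp add: shift_def)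
  qed
  then have "homeomorphic_map ?Y ?Y shift"
    using cs cpt metrizable_imp_Hausdorff_space[OF mtr] img
    by (intro continuous_imp_homeomorphic_map) (auto intro: inj_on_subset)
  then show "tds ?Y shift" unfolding tds_def using cpt mtr by blast
  show "factor_map mtopology T ?Y shift (code J g)"
    unfolding factor_map_def using cm shift_code by simp
qed

text \<open>Up to \<open>\<epsilon> / 2\<close> the metric sees finitely many coordinates, hence
  finitely many stages and a bounded window of times. Over \<open>n\<close> steps a function of
  stage \<open>p\<close> is nonzero about \<open>n / L p\<close> times at most, and each nonzero
  value meets at most two tents; this is the density.\<close>

lemma Widim_code_space_le:
  fixes L J :: "nat \<Rightarrow> nat"
  assumes cont: "\<And>p j. j < J p \<Longrightarrow> cont (g p j)" and nn: "\<And>p j x. j < J p \<Longrightarrow> x \<in> M \<Longrightarrow> 0 \<le> g p j x"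
    and L: "\<And>p. 0 < L p"
    and sep: "\<And>p j x a b. j < J p \<Longrightarrow> x \<in> M \<Longrightarrow> 0 < g p j (it a x) \<Longrightarrow> 0 < g p j (it b x) \<Longrightarrow> a < b \<Longrightarrow> int (L p) \<le> b - a"
    and density: "\<And>P. (\<Sum>p<P. 2 * real (J p) / real (L p)) \<le> \<beta>"
    and M: "M \<noteq> {}"
    and \<rho>: "Metric_space (code J g ` M) \<rho>" "Metric_space.mtopology (code J g ` M) \<rho> = code_space J g"
    and eps: "0 < \<epsilon>"
  shows "\<exists>C. \<forall>n>0. \<exists>D. Widim \<epsilon> (code J g ` M) (dyn_metric shift \<rho> n) \<le> enat D \<and> real D \<le> \<beta> * real n + C"
proof -
  let ?A = "code J g ` M"
  interpret Y: Metric_space ?A \<rho> by fact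
  have "compact_space (code_space J g)" using code_factor(1)[of J g, OF cont] by (simp add: tds_def)
  then obtain F \<eta> where F: "finite F" "0 < \<eta>"
    and "\<forall>y\<in>?A. \<forall>y'\<in>?A. (\<forall>c\<in>F. \<bar>y c - y' c\<bar> < \<eta>) \<longrightarrow> \<rho> y y' < \<epsilon> / 2"
    using finite_coordinates_control[OF \<rho>(1), of "\<epsilon> / 2"] \<rho>(2) eps unfolding code_space_def
    by (metis half_gt_zero)
  then have ctl: "\<rho> y y' < \<epsilon> / 2" if "y \<in> ?A" "y' \<in> ?A" "\<forall>c\<in>F. \<bar>y c - y' c\<bar> < \<eta>" for y y'
    using that by blast
  obtain pp jj ss where key: "\<And>c. c = key (pp c) (jj c) (ss c)" using key_surj by metis
  \<comment> \<open>Sums serve as upper bounds for maxima; \<open>Suc\<close> makes the bound on the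
    stages strict.\<close>
  define P where "P = Suc (\<Sum>c\<in>F. pp c)"
  define Q where "Q = (\<Sum>c\<in>F. nat \<bar>ss c\<bar>)"
  have PQ: "pp c < P" "\<bar>ss c\<bar> \<le> int Q" if "c \<in> F" for c
  proof -
    show "pp c < P" using member_le_sum[OF that _ F(1), of pp] by (auto simp: P_def)
    have "nat \<bar>ss c\<bar> \<le> Q" unfolding Q_def using that F(1) by (intro member_le_sum) auto
    then show "\<bar>ss c\<bar> \<le> int Q" by linarith
  qed
  define b where "b p j = (SOME b. 0 < b \<and> (\<forall>x\<in>M. g p j x < b))" for p j
  have b: "0 < b p j \<and> (\<forall>x\<in>M. g p j x < b p j)" if "j < J p" for p j
    unfolding b_def by (rule someI_ex[OF cont_bounded[OF cont[OF that]]])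
  \<comment> \<open>\<open>K\<close> tents of parameter \<open>\<eta> / 2\<close> reach beyond all
    values of the functions in stages below \<open>P\<close>.\<close>
  obtain K :: nat where K: "(\<Sum>p<P. \<Sum>j<J p. b p j) / (\<eta> / 2) \<le> real K" using real_arch_simple by blast
  have bK: "b p j \<le> \<eta> / 2 * real K" if "p < P" "j < J p" for p j
  proof -
    have "b p j \<le> (\<Sum>j<J p. b p j)" using that b by (intro member_le_sum) (auto simp: less_imp_le)
    also have "\<dots> \<le> (\<Sum>p<P. \<Sum>j<J p. b p j)"
      using that b by (intro member_le_sum[of p "{..<P}" "\<lambda>p. \<Sum>j<J p. b p j"]) (auto intro!: sum_nonneg simp: less_imp_le)
    finally show ?thesis using K F(2) by (simp add: field_simps)
  qed
  define C where "C = (\<Sum>p<P. real (J p) * (2 * (real (2 * Q) / real (L p) + 2)))"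
  have "\<exists>D. Widim \<epsilon> ?A (dyn_metric shift \<rho> n) \<le> enat D \<and> real D \<le> \<beta> * real n + C" if n: "n > 0" for n
  proof -
    define R where "R = {- int Q..int n + int Q}"
    \<comment> \<open>\<open>None\<close> indexes the constant 1, so that some coordinate is
      positive even where all sampled values vanish; it is the one extra vertex in
      \<open>Suc D\<close>.\<close>
    define W where "W = insert None (Some ` (SIGMA p:{..<P}. SIGMA j:{..<J p}. SIGMA s:R. {1..K}))"
    define h where "h w y = (case w of None \<Rightarrow> 1 | Some (p, j, s, l) \<Rightarrow> hat (\<eta> / 2) l (y (key p j s)))"
      for w and y :: "nat \<Rightarrow> real"
    have finW: "finite W" unfolding W_def by (auto simp: R_def)
    have A_range: "0 \<le> y (key p j s)" "y (key p j s) \<le> \<eta> / 2 * real K"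
      if y: "y \<in> ?A" and p: "p < P" "j < J p" for y p j s
    proof -
      obtain x where x: "x \<in> M" "y = code J g x" using y by auto
      then have eq: "y (key p j s) = g p j (it s x)" using p(2) by (simp add: code_key)
      show "0 \<le> y (key p j s)" unfolding eq by (rule nn[OF p(2) it_in[OF x(1)]])
      have "g p j (it s x) < b p j" using b[OF p(2)] it_in[OF x(1)] by blast
      then show "y (key p j s) \<le> \<eta> / 2 * real K" unfolding eq using bK[OF p] by linarith
    qed
    define E where "E y = (SIGMA p:{..<P}. SIGMA j:{..<J p}. SIGMA s:R. {l\<in>{1..K}. 0 < hat (\<eta> / 2) l (y (key p j s))})"
      for y :: "nat \<Rightarrow> real"
    have finE: "finite (E y)" for y unfolding E_def R_def by auto
    have card_E: "real (card (E y)) \<le> \<beta> * real n + C" if y: "y \<in> ?A" for y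
    proof -
      obtain x where x: "x \<in> M" "y = code J g x" using y by auto
      have one: "real (card (SIGMA s:R. {l\<in>{1..K}. 0 < hat (\<eta> / 2) l (y (key p j s))}))
          \<le> 2 * (real (n + 2 * Q) / real (L p) + 2)" if p: "p < P" "j < J p" for p j
      proof -
        let ?R = "{s\<in>R. 0 < g p j (it s x)}"
        have finR: "finite R" by (simp add: R_def)
        have "card (SIGMA s:R. {l\<in>{1..K}. 0 < hat (\<eta> / 2) l (y (key p j s))})
            = (\<Sum>s\<in>R. card {l\<in>{1..K}. 0 < hat (\<eta> / 2) l (y (key p j s))})"
          using finR by (intro card_SigmaI) auto
        also have "\<dots> \<le> (\<Sum>s\<in>R. if 0 < g p j (it s x) then 2 else 0)"
          using card_hat_pos[of "\<eta> / 2"] F(2) nn[OF p(2)] x p by (intro sum_mono) (simp add: code_key)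
        also have "\<dots> = 2 * card ?R"
          using finR by (simp add: sum.If_cases Int_def)
        finally have le: "real (card (SIGMA s:R. {l\<in>{1..K}. 0 < hat (\<eta> / 2) l (y (key p j s))})) \<le> 2 * real (card ?R)"
          by linarith
        have "real (card ?R) \<le> real_of_int (int n + int Q - (- int Q)) / real (L p) + 2"
          by (rule card_separated_le[OF _ L]) (use sep[OF p(2) x(1)] in \<open>auto simp: R_def\<close>)
        then have "real (card ?R) \<le> real (n + 2 * Q) / real (L p) + 2" by (simp add: algebra_simps)
        then have "2 * real (card ?R) \<le> 2 * (real (n + 2 * Q) / real (L p) + 2)" by (intro mult_left_mono) auto
        with le show ?thesis by (rule order_trans)
      qed
      have "real (card (E y)) = (\<Sum>p<P. \<Sum>j<J p. real (card (SIGMA s:R. {l\<in>{1..K}. 0 < hat (\<eta> / 2) l (y (key p j s))})))"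
        unfolding E_def by (subst card_SigmaI, simp, simp add: R_def, subst card_SigmaI) (auto simp: R_def)
      also have "\<dots> \<le> (\<Sum>p<P. \<Sum>j<J p. 2 * (real (n + 2 * Q) / real (L p) + 2))"
        by (intro sum_mono one) auto
      also have "\<dots> = (\<Sum>p<P. 2 * real (J p) / real (L p) * real n) + C"
        unfolding C_def sum.distrib[symmetric] by (intro sum.cong) (simp_all add: add_divide_distrib algebra_simps)
      also have "\<dots> = (\<Sum>p<P. 2 * real (J p) / real (L p)) * real n + C" by (simp add: sum_distrib_right)
      also have "\<dots> \<le> \<beta> * real n + C" by (intro add_right_mono mult_right_mono density) auto
      finally show ?thesis .
    qed
    define D where "D = nat \<lfloor>\<beta> * real n + C\<rfloor>"
    obtain x0 where x0: "x0 \<in> M" using M by blast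
    have shiftA: "shift ` ?A \<subseteq> ?A" using shift_image[of J g] by simp
    have ms: "Metric_space ?A (dyn_metric shift \<rho> n)" by (rule Y.Metric_space_dyn_metric[OF shiftA n])
    have incl: "continuous_map (Metric_space.mtopology ?A (dyn_metric shift \<rho> n)) (code_space J g) (\<lambda>y. y)"
      unfolding \<rho>(2)[symmetric]
      by (rule continuous_map_lipschitz[OF ms \<rho>(1)]) (use le_dyn_metric[of 0 n \<rho> shift] n in auto)
    have "Widim \<epsilon> ?A (dyn_metric shift \<rho> n) \<le> enat D"
    proof (rule Widim_le_support[OF ms _ finW, where h = h and e = "\<epsilon> / 2"])
      show "?A \<noteq> {}" using x0 by auto
      show "0 \<le> h w y" for w y by (auto simp: h_def hat_def split: option.split)
      show "\<exists>w\<in>W. 0 < h w y" for y by (rule bexI[of _ None]) (auto simp: h_def W_def)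
      show "\<epsilon> / 2 < \<epsilon>" using eps by simp
      show "continuous_map (Metric_space.mtopology ?A (dyn_metric shift \<rho> n)) euclideanreal (h w)" for w
      proof (cases w)
        case None then show ?thesis by (simp add: h_def[abs_def])
      next
        case (Some q)
        obtain p j s l where q: "q = (p, j, s, l)" by (cases q) auto
        have "continuous_map (code_space J g) euclideanreal (\<lambda>y. y (key p j s))"
          unfolding code_space_def by (rule continuous_map_coordinate)
        from continuous_map_compose[OF incl this]
        have "continuous_map (Metric_space.mtopology ?A (dyn_metric shift \<rho> n)) euclideanreal (\<lambda>y. y (key p j s))"
          by (simp add: o_def)
        then show ?thesis unfolding Some q h_def[abs_def] hat_def option.case prod.case
          using F(2) by (intro continuous_map_real_max continuous_map_diff continuous_map_real_abs continuous_map_real_divide) auto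
      qed
      show "card {w\<in>W. 0 < h w y} \<le> Suc D" if y: "y \<in> ?A" for y
      proof -
        have "{w\<in>W. 0 < h w y} \<subseteq> insert None (Some ` E y)" by (auto simp: W_def E_def h_def)
        then have "card {w\<in>W. 0 < h w y} \<le> card (insert None (Some ` E y))"
          using finE by (intro card_mono) auto
        also have "\<dots> \<le> Suc (card (E y))"
          using finE card_image_le[OF finE, of Some] by (simp add: card_insert_if)
        also have "card (E y) \<le> D" using card_E[OF y] unfolding D_def by linarith
        finally show ?thesis by simp
      qed
      show "dyn_metric shift \<rho> n y y' \<le> \<epsilon> / 2"
        if y: "y \<in> ?A" "y' \<in> ?A" and same: "\<And>w. w \<in> W \<Longrightarrow> 0 < h w y \<longleftrightarrow> 0 < h w y'" for y y'
        unfolding dyn_metric_le_iff[OF n]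
      proof (intro allI impI)
        fix i assume i: "i < n"
        have inA: "(shift ^^ i) u \<in> ?A" if "u \<in> ?A" for u using that shiftA by (induction i) auto
        have "\<bar>(shift ^^ i) y c - (shift ^^ i) y' c\<bar> < \<eta>" if c: "c \<in> F" for c
        proof -
          let ?p = "pp c" and ?j = "jj c" and ?s = "ss c + int i"
          have eq: "(shift ^^ i) u c = u (key ?p ?j ?s)" for u
            unfolding shift_funpow by (subst key[of c]) simp
          show ?thesis
          proof (cases "?j < J ?p")
            case False
            then have "u (key ?p ?j ?s) = 0" if "u \<in> ?A" for u using that by (auto simp: code_key)
            from this[OF y(1)] this[OF y(2)] show ?thesis unfolding eq using F(2) by simp
          next
            case True
            have sR: "?s \<in> R" using PQ(2)[OF c] i by (auto simp: R_def)
            have "\<bar>y (key ?p ?j ?s) - y' (key ?p ?j ?s)\<bar> < 2 * (\<eta> / 2)"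
            proof (rule hat_support_close)
              fix l assume l: "l \<in> {1..K}"
              have "Some (?p, ?j, ?s, l) \<in> W" using PQ(1)[OF c] True sR l by (auto simp: W_def)
              from same[OF this] show "0 < hat (\<eta> / 2) l (y (key ?p ?j ?s)) \<longleftrightarrow> 0 < hat (\<eta> / 2) l (y' (key ?p ?j ?s))"
                by (simp add: h_def)
            qed (use A_range y PQ(1)[OF c] True F(2) in auto)
            then show ?thesis unfolding eq by simp
          qed
        qed
        then show "\<rho> ((shift ^^ i) y) ((shift ^^ i) y') \<le> \<epsilon> / 2"
          using ctl[OF inA[OF y(1)] inA[OF y(2)]] by (auto intro: less_imp_le)
      qed
    qed
    moreover have "real D \<le> \<beta> * real n + C"
      unfolding D_def using card_E[of "code J g x0"] x0 by (auto intro: order_trans)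
    ultimately show ?thesis by blast
  qed
  then show ?thesis by blast
qed

end

section \<open>Choice of the scales and conclusion\<close>

lemma compatible_metric_exists:
  assumes "metrizable_space X"
  shows "compatible_metric X (SOME d. compatible_metric X d)"
proof -
  obtain M d where "Metric_space M d" "X = Metric_space.mtopology M d"
    using assms unfolding metrizable_space_def by blast
  then have "\<exists>d. compatible_metric X d"
    unfolding compatible_metric_def using Metric_space.topspace_mtopology by metis
  then show ?thesis by (rule someI_ex)
qed

lemma sum_half_powers_le: "(\<Sum>p<P. (1 / 2) ^ p) \<le> (2::real)"
proof -
  have "(\<Sum>p<P. (1 / 2) ^ p) = 2 - 2 * (1 / 2 :: real) ^ P" by (induction P) simp_all
  then show ?thesis by simp
qed

theorem theorem1p2:
  fixes X :: "'a topology" and T :: "'a \<Rightarrow> 'a" and z z' :: 'a and \<delta> :: real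
  assumes "tds X T"
    and "marker_property X T"
    and "mdim X T > 0"
    and "\<delta> > 0"
    and "z \<in> topspace X" and "z' \<in> topspace X" and "z \<noteq> z'"
  shows "\<exists>(Y :: (nat \<Rightarrow> real) topology) S \<pi>.
           tds Y S \<and> factor_map X T Y S \<pi> \<and>
           \<pi> z \<noteq> \<pi> z' \<and> mdim Y S < ereal \<delta> \<and> rel_mdim X T Y \<pi> = 0"
proof -
  \<comment> \<open>Taking exactly the metric selected in \<open>rel_mdim\<close> turns its
    definition into a statement about \<open>d\<close>.\<close>
  define d where "d = (SOME d. compatible_metric X d)"
  define M where "M = topspace X"
  have "compatible_metric X d" unfolding d_def using assms(1) by (simp add: tds_def compatible_metric_exists)
  then have ms: "Metric_space M d" and top: "Metric_space.mtopology M d = X"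
    unfolding compatible_metric_def M_def by auto
  interpret compact_dynamics M d T
    using assms(1) ms unfolding compact_dynamics_def compact_dynamics_axioms_def tds_def top by simp
  have z: "z \<in> M" "z' \<in> M" using assms unfolding M_def by auto
  \<comment> \<open>Twice the sum of the \<open>\<alpha> p\<close> is at most
    \<open>\<delta> / 2\<close>, strictly below \<delta>, while \<open>\<alpha> p\<close> tends to
    0.\<close>
  define \<alpha> where "\<alpha> p = \<delta> / 8 * (1 / 2) ^ p" for p :: nat
  define good where "good p L J g \<longleftrightarrow> L > 0 \<and> real J \<le> \<alpha> p * real L \<and>
    (\<forall>j<J. cont (g j) \<and> (\<forall>x\<in>M. 0 \<le> g j x)) \<and>
    (\<forall>i<J. \<forall>j<J. \<forall>x\<in>M. \<forall>a b. 0 < g i (it a x) \<longrightarrow> 0 < g j (it b x) \<longrightarrow> a < b \<longrightarrow> int L \<le> b - a) \<and>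
    (\<exists>j<J. \<exists>a. g j (it a z) \<noteq> g j (it a z')) \<and>
    (\<exists>C. \<forall>n>0. \<forall>Z. Z \<subseteq> M \<longrightarrow> Z \<noteq> {} \<longrightarrow>
       (\<forall>j<J. \<forall>a. \<forall>x\<in>Z. \<forall>y\<in>Z. g j (it a x) = g j (it a y)) \<longrightarrow>
       (\<exists>D. Widim (1 / real (Suc p)) Z (dyn_metric T d n) \<le> enat D \<and> real D \<le> \<alpha> p * real n + C))"
    for p and L J :: nat and g :: "nat \<Rightarrow> 'a \<Rightarrow> real"
  have "\<exists>L J g. good p L J g" for p
    unfolding good_def by (rule sparse_encoding) (use assms z in \<open>auto simp: top \<alpha>_def\<close>)
  then obtain L J g where "\<And>p. good p (L p) (J p) (g p)" by metis
  note stage = this[unfolded good_def]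
  have L_pos: "L p > 0" for p using stage[of p] by (elim conjE)
  have J_le: "real (J p) \<le> \<alpha> p * real (L p)" for p using stage[of p] by (elim conjE)
  have "\<forall>j<J p. cont (g p j) \<and> (\<forall>x\<in>M. 0 \<le> g p j x)" for p using stage[of p] by (elim conjE)
  then have cont_g: "cont (g p j)" and g_nonneg: "x \<in> M \<Longrightarrow> 0 \<le> g p j x" if "j < J p" for p j x
    using that by auto
  have "\<forall>i<J p. \<forall>j<J p. \<forall>x\<in>M. \<forall>a b. 0 < g p i (it a x) \<longrightarrow> 0 < g p j (it b x) \<longrightarrow> a < b \<longrightarrow> int (L p) \<le> b - a"
    for p using stage[of p] by (elim conjE)
  then have g_sep: "int (L p) \<le> b - a" if "j < J p" "x \<in> M" "0 < g p j (it a x)" "0 < g p j (it b x)" "a < b" for p j x a b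
    using that by blast
  have g_distinguishes: "\<exists>j<J p. \<exists>a. g p j (it a z) \<noteq> g p j (it a z')" for p using stage[of p] by (elim conjE)
  have fibres: "\<exists>C. \<forall>n>0. \<forall>Z. Z \<subseteq> M \<longrightarrow> Z \<noteq> {} \<longrightarrow>
       (\<forall>j<J p. \<forall>a. \<forall>x\<in>Z. \<forall>y\<in>Z. g p j (it a x) = g p j (it a y)) \<longrightarrow>
       (\<exists>D. Widim (1 / real (Suc p)) Z (dyn_metric T d n) \<le> enat D \<and> real D \<le> \<alpha> p * real n + C)" for p
    using stage[of p] by (elim conjE)
  let ?Y = "code_space J g" and ?\<pi> = "code J g"
  have Y: "tds ?Y shift" and fm: "factor_map X T ?Y shift ?\<pi>"
    using code_factor[OF cont_g] by (auto simp: top)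
  have sep: "?\<pi> z \<noteq> ?\<pi> z'"
  proof -
    obtain j a where "j < J 0" "g 0 j (it a z) \<noteq> g 0 j (it a z')" using g_distinguishes by blast
    then have "?\<pi> z (key 0 j a) \<noteq> ?\<pi> z' (key 0 j a)" by (simp add: code_key)
    then show ?thesis by metis
  qed
  have mdim_Y: "mdim ?Y shift \<le> ereal (\<delta> / 2)"
  proof -
    define \<rho> where "\<rho> = (SOME d. compatible_metric ?Y d)"
    have "compatible_metric ?Y \<rho>" unfolding \<rho>_def using Y by (simp add: tds_def compatible_metric_exists)
    then have \<rho>: "Metric_space (?\<pi> ` M) \<rho>" "Metric_space.mtopology (?\<pi> ` M) \<rho> = ?Y"
      unfolding compatible_metric_def by auto
    interpret Y: Metric_space "?\<pi> ` M" \<rho> by fact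
    have density: "(\<Sum>p<P. 2 * real (J p) / real (L p)) \<le> \<delta> / 2" for P
    proof -
      have "2 * real (J p) / real (L p) \<le> \<delta> / 4 * (1 / 2) ^ p" for p
      proof -
        show ?thesis using L_pos[of p] J_le[of p] by (simp add: divide_le_eq \<alpha>_def)
      qed
      then have "(\<Sum>p<P. 2 * real (J p) / real (L p)) \<le> (\<Sum>p<P. \<delta> / 4 * (1 / 2) ^ p)" by (intro sum_mono)
      also have "\<dots> = \<delta> / 4 * (\<Sum>p<P. (1 / 2) ^ p)" by (simp add: sum_distrib_left)
      also have "\<dots> \<le> \<delta> / 4 * 2" using assms(4) by (intro mult_left_mono sum_half_powers_le) auto
      finally show ?thesis by simp
    qed
    \<comment> \<open>The whole factor space is treated as a family with a single member.\<close>
    have "0 \<le> Lim (at_right 0) (\<lambda>\<epsilon>. lim (\<lambda>n. ereal_of_enat (SUP i\<in>{()}. Widim \<epsilon> (?\<pi> ` M) (dyn_metric shift \<rho> n)) / ereal (real n))) \<and>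
      Lim (at_right 0) (\<lambda>\<epsilon>. lim (\<lambda>n. ereal_of_enat (SUP i\<in>{()}. Widim \<epsilon> (?\<pi> ` M) (dyn_metric shift \<rho> n)) / ereal (real n))) \<le> ereal (\<delta> / 2)"
    proof (rule Y.mean_Widim_le[where s = id])
      show "shift ` (?\<pi> ` M) \<subseteq> ?\<pi> ` M" using shift_image[of J g] by simp
      then show "?\<pi> ` M \<subseteq> ?\<pi> ` M \<and> ?\<pi> ` M \<noteq> {} \<and> shift ` (?\<pi> ` M) \<subseteq> ?\<pi> ` M" using z by auto
      fix \<epsilon> :: real assume "0 < \<epsilon>"
      have "\<exists>C. \<forall>n>0. \<exists>D. Widim \<epsilon> (?\<pi> ` M) (dyn_metric shift \<rho> n) \<le> enat D \<and> real D \<le> \<delta> / 2 * real n + C"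
        by (rule Widim_code_space_le[where L = L, OF cont_g g_nonneg L_pos g_sep density _ \<rho> \<open>0 < \<epsilon>\<close>])
          (use z in auto)
      then show "\<exists>C. \<forall>n>0. \<forall>i\<in>{()}. \<exists>D. Widim \<epsilon> (?\<pi> ` M) (dyn_metric shift \<rho> n) \<le> enat D \<and> real D \<le> \<delta> / 2 * real n + C"
        by simp
    qed auto
    then show ?thesis unfolding mdim_def mdim_wrt_def \<rho>_def[symmetric] by simp
  qed
  \<comment> \<open>Points of one fibre of the full code agree on every stage. A single stage with
    scale \<open>1 / (p + 1)\<close> below \<epsilon> and \<open>\<alpha> p \<le> \<gamma>\<close>
    therefore bounds the width of the fibre, and \<gamma> is arbitrary.\<close>
  have rel: "0 \<le> rel_mdim X T ?Y ?\<pi> \<and> rel_mdim X T ?Y ?\<pi> \<le> ereal \<gamma>" if \<gamma>: "\<gamma> > 0" for \<gamma>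
    unfolding rel_mdim_def rel_mdim_wrt_def d_def[symmetric]
  proof (rule mean_Widim_le[where s = shift])
    show "T ` M \<subseteq> M" using T_surj by simp
    show "topspace ?Y \<noteq> {}" using z by auto
    show "shift ` topspace ?Y \<subseteq> topspace ?Y" using shift_image[of J g] by simp
    show "{x \<in> topspace X. ?\<pi> x = y} \<subseteq> M \<and> {x \<in> topspace X. ?\<pi> x = y} \<noteq> {} \<and>
        T ` {x \<in> topspace X. ?\<pi> x = y} \<subseteq> {x \<in> topspace X. ?\<pi> x = shift y}" if "y \<in> topspace ?Y" for y
    proof -
      have "T x \<in> M \<and> ?\<pi> (T x) = shift y" if "x \<in> M" "?\<pi> x = y" for x
        using that(2) imageI[OF that(1), of T] shift_code[OF that(1), of J g] unfolding T_surj by simp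
      then show ?thesis using that unfolding M_def[symmetric] by auto
    qed
    fix \<epsilon> :: real assume eps: "0 < \<epsilon>"
    obtain p :: nat where p: "1 / real (Suc p) \<le> \<epsilon>" "\<alpha> p \<le> \<gamma>"
    proof -
      obtain p1 :: nat where p1: "1 / \<epsilon> \<le> real p1" using real_arch_simple by blast
      obtain p2 :: nat where p2: "(1 / 2) ^ p2 < \<gamma> / (\<delta> / 8)"
        using real_arch_pow_inv[of "\<gamma> / (\<delta> / 8)" "1 / 2"] \<gamma> assms(4) by auto
      show ?thesis
      proof (rule that[of "p1 + p2"])
        have "1 / \<epsilon> \<le> real (Suc (p1 + p2))" using p1 by simp
        then show "1 / real (Suc (p1 + p2)) \<le> \<epsilon>" using eps by (simp add: field_simps)
        have "(1 / 2 :: real) ^ (p1 + p2) \<le> (1 / 2) ^ p2" by (intro power_decreasing) auto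
        also note p2
        finally have "(1 / 2) ^ (p1 + p2) < \<gamma> / (\<delta> / 8)" .
        then have "\<delta> / 8 * (1 / 2) ^ (p1 + p2) \<le> \<delta> / 8 * (\<gamma> / (\<delta> / 8))"
          using assms(4) by (intro mult_left_mono) (auto intro: less_imp_le)
        then show "\<alpha> (p1 + p2) \<le> \<gamma>" using assms(4) by (simp add: \<alpha>_def)
      qed
    qed
    obtain C where C: "\<forall>n>0. \<forall>Z. Z \<subseteq> M \<longrightarrow> Z \<noteq> {} \<longrightarrow>
       (\<forall>j<J p. \<forall>a. \<forall>x\<in>Z. \<forall>y\<in>Z. g p j (it a x) = g p j (it a y)) \<longrightarrow>
       (\<exists>D. Widim (1 / real (Suc p)) Z (dyn_metric T d n) \<le> enat D \<and> real D \<le> \<alpha> p * real n + C)"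
      using fibres by blast
    have "\<exists>D. Widim \<epsilon> {x \<in> topspace X. ?\<pi> x = y} (dyn_metric T d n) \<le> enat D \<and> real D \<le> \<gamma> * real n + C"
      if n: "n > 0" and y: "y \<in> topspace ?Y" for n y
    proof -
      let ?Z = "{x \<in> topspace X. ?\<pi> x = y}"
      have Z: "?Z \<subseteq> M" "?Z \<noteq> {}" using y unfolding M_def[symmetric] by auto
      have "g p j (it a x) = g p j (it a x')" if "j < J p" "x \<in> ?Z" "x' \<in> ?Z" for j a x x'
      proof -
        have "?\<pi> x (key p j a) = ?\<pi> x' (key p j a)" using that(2,3) by simp
        then show ?thesis using that(1) by (simp add: code_key)
      qed
      then have "\<forall>j<J p. \<forall>a. \<forall>x\<in>?Z. \<forall>x'\<in>?Z. g p j (it a x) = g p j (it a x')" by blast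
      from C[rule_format, OF n Z(1)] Z(2) this
      obtain D where D: "Widim (1 / real (Suc p)) ?Z (dyn_metric T d n) \<le> enat D" "real D \<le> \<alpha> p * real n + C"
        by blast
      have "\<alpha> p * real n \<le> \<gamma> * real n" using p(2) by (intro mult_right_mono) auto
      then show ?thesis using D Widim_mono_eps[OF p(1), of ?Z "dyn_metric T d n"] by (meson add_right_mono order_trans)
    qed
    then show "\<exists>C. \<forall>n>0. \<forall>y\<in>topspace ?Y. \<exists>D. Widim \<epsilon> {x \<in> topspace X. ?\<pi> x = y} (dyn_metric T d n) \<le> enat D \<and>
        real D \<le> \<gamma> * real n + C" by blast
  qed
  have "rel_mdim X T ?Y ?\<pi> = 0"
  proof (rule antisym)
    show "rel_mdim X T ?Y ?\<pi> \<le> 0"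
      by (rule ereal_le_epsilon2) (use rel in auto)
  qed (use rel[of 1] in simp)
  moreover have "mdim ?Y shift < ereal \<delta>"
    using mdim_Y assms(4) by (auto intro: le_less_trans)
  ultimately show ?thesis using Y fm sep by blast
qed

end
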